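(* For every $0\le\rho<\rho^*$, the product measure $\nu_\rho$ on $\mathbb{N}_0^{\mathbb{Z}^d}$ is an invariant measure for the zero-range process on $\mathbb{Z}^d$; that is, $\nu_\rho\in\mathcal{I}$.
   Context: $\mathbb{N}_0=\{0,1,2,\ldots\}$. The rate $g:\mathbb{N}_0\to[0,\infty)$ satisfies $g(0)=0$, $g(k)>0$ for $k\ge1$, and $\sup_{k\ge0}|g(k+1)-g(k)|\le a_0<\infty$. $p$ is an irreducible translation-invariant transition probability on $\mathbb{Z}^d$, $p(x,y)=p(y-x)$, not necessarily finite-range; $p^{(n)}$ is the $n$-step probability. Set $\beta(x)=\sum_{n\ge0}2^{-n}p^{(n)}(x,0)$, $\|\eta-\zeta\|=\sum_x|\eta(x)-\zeta(x)|\beta(x)$, $\|\eta\|=\sum_x\eta(x)\beta(x)$, $\Omega'=\{\eta\in\mathbb{N}_0^{\mathbb{Z}^d}:\|\eta\|<\infty\}$. $\mathcal{L}$ is the set of $f:\Omega'\to\mathbb{R}$ with $|f(\eta)-f(\zeta)|\le c\|\eta-\zeta\|$ for some $c$ and all $\eta,\zeta\in\Omega'$; $c(f)$ is the smallest such $c$. $L f(\eta)=\sum_{x,y\in\mathbb{Z}^d}p(y)g(\eta(x))[f(\eta^{x,x+y})-f(\eta)]$, $\eta^{x,z}$ being $\eta$ with one particle moved from $x$ to $z$. $(P_t)$ is the zero-range semigroup on $\mathcal{L}$: the unique semigroup of linear operators on $\mathcal{L}$ with $P_tf(\eta)=E^\eta[f(\eta_t)]$ for finite $\eta$ (finitely many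 particles; $\eta_t$ the countable-state Markov chain with generator $L$) and $c(P_tf)\le c(f)e^{4a_0t}$. A probability measure $\mu$ on $\Omega'$ is an invariant measure, $\mu\in\mathcal{I}$, if $\int P_tf\,d\mu=\int f\,d\mu$ for all bounded $f\in\mathcal{L}$ and $t\geq 0$. For $0\le\psi<\liminf_kg(k)$ let $\kappa_\psi(k)=Z(\psi)^{-1}\psi^k/(g(1)\cdots g(k))$, $k\ge 0$ (empty product $1$ for $k=0$), with normalization $Z(\psi)$; let $\rho(\psi)$ be its mean (strictly increasing in $\psi$), $\Psi(\cdot)$ the inverse function of $\rho(\cdot)$, $\rho^*=\lim_{\psi\uparrow\liminf g(k)}\rho(\psi)$, and $\nu_\rho=\prod_{x\in\mathbb{Z}^d}\kappa_{\Psi(\rho)}$; one has $\nu_\rho(\Omega')=1$. *)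

theory Defs
  imports "HOL-Probability.Probability"
begin

type_synonym 'd site = "int ^ 'd"
type_synonym 'd config = "'d site \<Rightarrow> nat"

text \<open>
  A translation-invariant transition probability \<open>p(x,y) = p(y - x)\<close> is given by the law
  \<open>p\<close> of one increment.
\<close>

primrec nstep :: "('d::finite) site pmf \<Rightarrow> nat \<Rightarrow> 'd site \<Rightarrow> 'd site pmf" where
  "nstep p 0 x = return_pmf x"
| "nstep p (Suc n) x = bind_pmf (nstep p n x) (\<lambda>z. map_pmf (\<lambda>y. z + y) p)"

definition irreducible_walk :: "('d::finite) site pmf \<Rightarrow> bool" where
  "irreducible_walk p \<longleftrightarrow> (\<forall>x y. \<exists>n. pmf (nstep p n x) y > 0)"

definition beta :: "('d::finite) site pmf \<Rightarrow> 'd site \<Rightarrow> real" where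
  "beta p x = (\<Sum>n. (1/2) ^ n * pmf (nstep p n x) 0)"

definition Omega' :: "('d::finite) site pmf \<Rightarrow> 'd config set" where
  "Omega' p = {\<eta>. (\<lambda>x. real (\<eta> x) * beta p x) summable_on UNIV}"

definition config_dist :: "('d::finite) site pmf \<Rightarrow> 'd config \<Rightarrow> 'd config \<Rightarrow> real" where
  "config_dist p \<eta> \<zeta> = (\<Sum>\<^sub>\<infinity>x. \<bar>real (\<eta> x) - real (\<zeta> x)\<bar> * beta p x)"

definition lip_bound :: "('d::finite) site pmf \<Rightarrow> real \<Rightarrow> ('d config \<Rightarrow> real) \<Rightarrow> bool" where
  "lip_bound p c f \<longleftrightarrow> (\<forall>\<eta>\<in>Omega' p. \<forall>\<zeta>\<in>Omega' p. \<bar>f \<eta> - f \<zeta>\<bar> \<le> c * config_dist p \<eta> \<zeta>)"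

text \<open>Functions \<open>\<Omega>' \<rightarrow> \<real>\<close> are represented by total functions that are \<open>undefined\<close> off \<open>\<Omega>'\<close>.\<close>

definition lip_functions :: "('d::finite) site pmf \<Rightarrow> ('d config \<Rightarrow> real) set" where
  "lip_functions p = {f \<in> extensional (Omega' p). \<exists>c. lip_bound p c f}"

text \<open>The infimum is attained, since the admissible constants form a closed set bounded below.\<close>

definition lip_const :: "('d::finite) site pmf \<Rightarrow> ('d config \<Rightarrow> real) \<Rightarrow> real" where
  "lip_const p f = Inf {c. lip_bound p c f}"

text \<open>
  When \<open>\<eta> x = 0\<close> the value is irrelevant: below, it is always multiplied by \<open>g 0 = 0\<close>.
\<close>

definition move :: "('d::finite) config \<Rightarrow> 'd site \<Rightarrow> 'd site \<Rightarrow> 'd config" where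
  "move \<eta> x z = (let \<eta>' = \<eta>(x := \<eta> x - 1) in \<eta>'(z := \<eta>' z + 1))"

definition zr_generator ::
  "('d::finite) site pmf \<Rightarrow> (nat \<Rightarrow> real) \<Rightarrow> ('d config \<Rightarrow> real) \<Rightarrow> 'd config \<Rightarrow> real" where
  "zr_generator p g f \<eta> =
     (\<Sum>\<^sub>\<infinity>(x, y). pmf p y * g (\<eta> x) * (f (move \<eta> x (x + y)) - f \<eta>))"

definition finite_configs :: "('d::finite) config set" where
  "finite_configs = {\<eta>. finite {x. \<eta> x \<noteq> 0}}"

text \<open>
  \<open>K t \<eta>\<close> is the law at time \<open>t\<close> of the Markov chain on the countable set of finite
  configurations started from \<open>\<eta>\<close>. On configurations with a fixed number of particles the
  jump rates are bounded, so the conditions below determine \<open>K\<close> on finite configurations.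
\<close>

definition zr_chain ::
  "('d::finite) site pmf \<Rightarrow> (nat \<Rightarrow> real) \<Rightarrow> (real \<Rightarrow> 'd config \<Rightarrow> 'd config pmf) \<Rightarrow> bool" where
  "zr_chain p g K \<longleftrightarrow>
     (\<forall>t\<ge>0. \<forall>\<eta>\<in>finite_configs. set_pmf (K t \<eta>) \<subseteq> finite_configs) \<and>
     (\<forall>\<eta>\<in>finite_configs. K 0 \<eta> = return_pmf \<eta>) \<and>
     (\<forall>s\<ge>0. \<forall>t\<ge>0. \<forall>\<eta>\<in>finite_configs. K (s + t) \<eta> = bind_pmf (K s \<eta>) (K t)) \<and>
     (\<forall>f. bounded (range f) \<longrightarrow> (\<forall>\<eta>\<in>finite_configs.
        ((\<lambda>t. measure_pmf.expectation (K t \<eta>) f) has_real_derivative zr_generator p g f \<eta>)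
          (at_right 0)))"

definition zr_semigroup ::
  "('d::finite) site pmf \<Rightarrow> real \<Rightarrow> (real \<Rightarrow> 'd config \<Rightarrow> 'd config pmf) \<Rightarrow>
   (real \<Rightarrow> ('d config \<Rightarrow> real) \<Rightarrow> 'd config \<Rightarrow> real) \<Rightarrow> bool" where
  "zr_semigroup p a0 K P \<longleftrightarrow>
     (\<forall>t\<ge>0. \<forall>f\<in>lip_functions p. P t f \<in> lip_functions p) \<and>
     (\<forall>t\<ge>0. \<forall>f\<in>lip_functions p. \<forall>h\<in>lip_functions p. \<forall>a b.
        P t (\<lambda>\<eta>\<in>Omega' p. a * f \<eta> + b * h \<eta>) = (\<lambda>\<eta>\<in>Omega' p. a * P t f \<eta> + b * P t h \<eta>)) \<and>
     (\<forall>f\<in>lip_functions p. P 0 f = f) \<and>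
     (\<forall>s\<ge>0. \<forall>t\<ge>0. \<forall>f\<in>lip_functions p. P (s + t) f = P s (P t f)) \<and>
     (\<forall>t\<ge>0. \<forall>f\<in>lip_functions p. \<forall>\<eta>\<in>finite_configs.
        P t f \<eta> = measure_pmf.expectation (K t \<eta>) f) \<and>
     (\<forall>t\<ge>0. \<forall>f\<in>lip_functions p. lip_const p (P t f) \<le> lip_const p f * exp (4 * a0 * t))"

text \<open>
  A probability measure on \<open>\<Omega>'\<close> is represented as one on the product space that is
  concentrated on \<open>\<Omega>'\<close>.
\<close>

definition invariant_measures ::
  "('d::finite) site pmf \<Rightarrow> (real \<Rightarrow> ('d config \<Rightarrow> real) \<Rightarrow> 'd config \<Rightarrow> real) \<Rightarrow>
   'd config measure set" where
  "invariant_measures p P =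
     {\<mu>. prob_space \<mu> \<and> sets \<mu> = sets (\<Pi>\<^sub>M x\<in>UNIV. count_space UNIV) \<and>
         Omega' p \<in> sets \<mu> \<and> emeasure \<mu> (Omega' p) = 1 \<and>
         (\<forall>f\<in>lip_functions p. bounded (f ` Omega' p) \<longrightarrow>
            (\<forall>t\<ge>0. (LINT \<eta>:Omega' p|\<mu>. P t f \<eta>) = (LINT \<eta>:Omega' p|\<mu>. f \<eta>)))}"

text \<open>The limit inferior of the rate may be infinite.\<close>

definition crit_fugacity :: "(nat \<Rightarrow> real) \<Rightarrow> ereal" where
  "crit_fugacity g = liminf (\<lambda>k. ereal (g k))"

definition fugacities :: "(nat \<Rightarrow> real) \<Rightarrow> real set" where
  "fugacities g = {\<psi>. 0 \<le> \<psi> \<and> ereal \<psi> < crit_fugacity g}"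

definition weight :: "(nat \<Rightarrow> real) \<Rightarrow> real \<Rightarrow> nat \<Rightarrow> real" where
  "weight g \<psi> k = \<psi> ^ k / (\<Prod>i=1..k. g i)"

definition kappa :: "(nat \<Rightarrow> real) \<Rightarrow> real \<Rightarrow> nat pmf" where
  "kappa g \<psi> = embed_pmf (\<lambda>k. weight g \<psi> k / (\<Sum>j. weight g \<psi> j))"

definition density_of :: "(nat \<Rightarrow> real) \<Rightarrow> real \<Rightarrow> real" where
  "density_of g \<psi> = measure_pmf.expectation (kappa g \<psi>) real"

definition fugacity_of :: "(nat \<Rightarrow> real) \<Rightarrow> real \<Rightarrow> real" where
  "fugacity_of g = the_inv_into (fugacities g) (density_of g)"

text \<open>
  The limit is taken in the extended reals, where both \<open>\<psi>\<close> and the density may tend to infinity.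
  If the limit inferior of \<open>g\<close> is \<open>0\<close> there is no admissible \<open>\<psi>\<close>, hence no admissible
  density, and the value \<open>0\<close> makes the range \<open>0 \<le> \<rho> < \<rho>\<^sup>*\<close> empty.
\<close>

definition crit_density :: "(nat \<Rightarrow> real) \<Rightarrow> ereal" where
  "crit_density g =
     (if crit_fugacity g \<le> 0 then 0
      else Lim (at_left (crit_fugacity g)) (\<lambda>\<psi>. ereal (density_of g (real_of_ereal \<psi>))))"

definition nu :: "(nat \<Rightarrow> real) \<Rightarrow> real \<Rightarrow> ('d::finite) config measure" where
  "nu g \<rho> = (\<Pi>\<^sub>M x\<in>UNIV. measure_pmf (kappa g (fugacity_of g \<rho>)))"

end

theory Submission
  imports Defs
begin

text \<open>
  Work with the product law on a finite box \<open>A\<close>, empty outside, and with the dynamics on the whole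
  lattice started from it, so that only finite configurations occur. For \<open>h = P t f\<close> the relation
  \<open>\<kappa>(k + 1) g(k + 1) = \<psi> \<kappa>(k)\<close> turns \<open>\<integral> L h\<close> into
  \<open>\<psi> \<integral> (\<Sum>x\<in>A. \<Sum>y. p y (h (\<eta> + \<delta>\<^sub>x\<^sub>+\<^sub>y) - h (\<eta> + \<delta>\<^sub>x)))\<close>. Since \<open>p\<close> is doubly stochastic and
  \<open>\<bar>h (\<eta> + \<delta>\<^sub>z) - h \<eta>\<bar> \<le> c(h) \<beta> z\<close> with \<open>\<beta>\<close> summable, this is at most a constant times a boundary term
  that vanishes as \<open>A\<close> exhausts the lattice. As \<open>c(P t f)\<close> stays bounded on bounded time intervals,
  \<open>\<integral> P t f\<close> is constant in \<open>t\<close> up to this error, and the Lipschitz property of \<open>P t f\<close> together with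
  \<open>\<nu>(\<Omega>') = 1\<close> carries the identity over to \<open>\<nu>\<close>.
\<close>

section \<open>Single-site weights and the fugacity\<close>

lemma weight_0 [simp]: "weight g \<psi> 0 = 1"
  by (simp add: weight_def)

lemma weight_Suc: "weight g \<psi> (Suc k) = weight g \<psi> k * \<psi> / g (Suc k)"
  by (simp add: weight_def prod.nat_ivl_Suc' field_simps)

lemma weight_eq_powser: "weight g \<psi> k = weight g 1 k * \<psi> ^ k"
  by (simp add: weight_def)

lemma weight_nonneg:
  assumes "\<And>k. k \<ge> 1 \<Longrightarrow> g k > 0" "0 \<le> \<psi>"
  shows "weight g \<psi> k \<ge> 0"
  unfolding weight_def using assms by (intro divide_nonneg_nonneg prod_nonneg) (auto intro: less_imp_le)

text \<open>The strict inequality in \<open>fugacities\<close> leaves room for a larger admissible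
  \<open>K\<close>, which serves below as the ratio of a geometric comparison and as a point of
  convergence beyond \<open>\<psi>\<close>.\<close>

lemma fugacities_above:
  assumes "\<psi> \<in> fugacities g"
  obtains K where "K \<in> fugacities g" "\<psi> < K"
proof -
  from assms have "ereal \<psi> < crit_fugacity g" "0 \<le> \<psi>" by (auto simp: fugacities_def)
  then obtain K where "ereal \<psi> < ereal K" "ereal K < crit_fugacity g"
    using ereal_dense2 by blast
  with \<open>0 \<le> \<psi>\<close> have "K \<in> fugacities g" "\<psi> < K" by (auto simp: fugacities_def)
  then show ?thesis by (rule that)
qed

text \<open>Ratio test: eventually \<open>g k\<close> exceeds \<open>K\<close>, so consecutive
  weights shrink at least by the factor \<open>\<psi> / K\<close>, which is below one.\<close>

lemma summable_weight:
  assumes g: "\<And>k. k \<ge> 1 \<Longrightarrow> g k > 0" and \<psi>: "\<psi> \<in> fugacities g"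
  shows "summable (weight g \<psi>)"
proof -
  obtain K where K: "K \<in> fugacities g" "\<psi> < K" using \<psi> by (rule fugacities_above)
  have \<psi>0: "0 \<le> \<psi>" using \<psi> by (simp add: fugacities_def)
  have "eventually (\<lambda>k. ereal K < ereal (g k)) sequentially"
    using K by (intro less_LiminfD) (auto simp: fugacities_def crit_fugacity_def)
  then obtain N where N: "\<And>k. k \<ge> N \<Longrightarrow> K < g k"
    by (auto simp: eventually_sequentially)
  show ?thesis
  proof (rule summable_ratio_test)
    show "\<psi> / K < 1" using K \<psi>0 by simp
    fix n assume "N \<le> n"
    then have "K < g (Suc n)" using N by simp
    have "norm (weight g \<psi> (Suc n)) = weight g \<psi> n * (\<psi> / g (Suc n))"
      using weight_nonneg[of g, OF g \<psi>0] g[of "Suc n"] \<psi>0 by (simp add: weight_Suc abs_mult)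
    also have "\<dots> \<le> weight g \<psi> n * (\<psi> / K)"
      using \<open>K < g (Suc n)\<close> K \<psi>0 weight_nonneg[of g, OF g \<psi>0]
      by (intro mult_left_mono divide_left_mono) auto
    finally show "norm (weight g \<psi> (Suc n)) \<le> \<psi> / K * norm (weight g \<psi> n)"
      using weight_nonneg[of g, OF g \<psi>0] by (simp add: mult.commute)
  qed
qed

text \<open>Since \<open>real k * (\<psi> / K) ^ k\<close> tends to zero, the first-moment series at
  \<open>\<psi>\<close> is eventually dominated by the plain weights at the larger fugacity
  \<open>K\<close>.\<close>

lemma summable_real_weight:
  assumes g: "\<And>k. k \<ge> 1 \<Longrightarrow> g k > 0" and \<psi>: "\<psi> \<in> fugacities g"
  shows "summable (\<lambda>k. real k * weight g \<psi> k)"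
proof -
  obtain K where K: "K \<in> fugacities g" "\<psi> < K" using \<psi> by (rule fugacities_above)
  have \<psi>0: "0 \<le> \<psi>" using \<psi> by (simp add: fugacities_def)
  have "(\<lambda>k. real k * (\<psi> / K) ^ k) \<longlonglongrightarrow> 0"
    using K \<psi>0 by (intro powser_times_n_limit_0) auto
  then have "eventually (\<lambda>k. real k * (\<psi> / K) ^ k < 1) sequentially"
    by (rule order_tendstoD) simp
  then have "eventually (\<lambda>k. norm (real k * weight g \<psi> k) \<le> weight g K k) sequentially"
  proof eventually_elim
    fix k assume k: "real k * (\<psi> / K) ^ k < 1"
    have "norm (real k * weight g \<psi> k) = real k * weight g \<psi> k"
      using weight_nonneg[of g, OF g \<psi>0] by (simp add: abs_mult)
    also have "\<dots> = weight g K k * (real k * (\<psi> / K) ^ k)"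
      using K \<psi>0 by (simp add: weight_def power_divide)
    also have "\<dots> \<le> weight g K k * 1"
      using k K \<psi>0 weight_nonneg[of g K, OF g] by (intro mult_left_mono) auto
    finally show "norm (real k * weight g \<psi> k) \<le> weight g K k" by simp
  qed
  then show ?thesis by (rule summable_comparison_test_ev) (rule summable_weight[OF g K(1)])
qed

lemma partition_ge_1:
  assumes g: "\<And>k. k \<ge> 1 \<Longrightarrow> g k > 0" and \<psi>: "\<psi> \<in> fugacities g"
  shows "(\<Sum>j. weight g \<psi> j) \<ge> 1"
proof -
  have "0 \<le> \<psi>" using \<psi> by (simp add: fugacities_def)
  then have "(\<Sum>j<1. weight g \<psi> j) \<le> (\<Sum>j. weight g \<psi> j)"
    by (intro sum_le_suminf summable_weight[of g, OF g \<psi>]) (auto intro: weight_nonneg[of g, OF g])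
  then show ?thesis by simp
qed

lemma pmf_kappa:
  assumes g: "\<And>k. k \<ge> 1 \<Longrightarrow> g k > 0" and \<psi>: "\<psi> \<in> fugacities g"
  shows "pmf (kappa g \<psi>) k = weight g \<psi> k / (\<Sum>j. weight g \<psi> j)"
proof -
  let ?Z = "\<Sum>j. weight g \<psi> j"
  have \<psi>0: "0 \<le> \<psi>" using \<psi> by (simp add: fugacities_def)
  have Z: "?Z \<ge> 1" by (rule partition_ge_1[OF g \<psi>])
  have nn: "weight g \<psi> k / ?Z \<ge> 0" for k
    using Z weight_nonneg[of g, OF g \<psi>0] by (intro divide_nonneg_nonneg) auto
  have s: "summable (\<lambda>k. weight g \<psi> k / ?Z)"
    by (intro summable_divide summable_weight g \<psi>)
  have "(\<integral>\<^sup>+k. ennreal (weight g \<psi> k / ?Z) \<partial>count_space UNIV) = ennreal (\<Sum>k. weight g \<psi> k / ?Z)"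
    by (simp only: nn_integral_count_space_nat suminf_ennreal2[OF nn s])
  also have "(\<Sum>k. weight g \<psi> k / ?Z) = 1"
    using Z suminf_divide[OF summable_weight[of g, OF g \<psi>], of ?Z] by simp
  finally show ?thesis unfolding kappa_def using nn by (intro pmf_embed_pmf) auto
qed

text \<open>The normalization cancels in the recursion for the weights. This relation is the only
  feature of the one-site law, besides integrability, that the box estimates use.\<close>

lemma kappa_shift:
  assumes g: "\<And>k. k \<ge> 1 \<Longrightarrow> g k > 0" and \<psi>: "\<psi> \<in> fugacities g"
  shows "pmf (kappa g \<psi>) (Suc k) * g (Suc k) = \<psi> * pmf (kappa g \<psi>) k"
  using g[of "Suc k"] by (simp add: pmf_kappa[OF g \<psi>] weight_Suc field_simps)

section \<open>Moments of laws on the natural numbers and the density as a function of the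
  fugacity\<close>

lemma integrable_pmf_nat_iff:
  "integrable (measure_pmf q) f \<longleftrightarrow> summable (\<lambda>k. pmf q k * \<bar>f k\<bar>)" for f :: "nat \<Rightarrow> real"
  by (simp add: measure_pmf_eq_density integrable_density integrable_count_space_nat_iff abs_mult)

lemma integral_pmf_nat:
  fixes f :: "nat \<Rightarrow> real"
  assumes "summable (\<lambda>k. pmf q k * \<bar>f k\<bar>)"
  shows "measure_pmf.expectation q f = (\<Sum>k. pmf q k * f k)"
  using assms
  by (simp add: measure_pmf_eq_density integral_density integral_count_space_nat
        integrable_count_space_nat_iff abs_mult)

lemma integrable_kappa_real:
  assumes g: "\<And>k. k \<ge> 1 \<Longrightarrow> g k > 0" and \<psi>: "\<psi> \<in> fugacities g"
  shows "integrable (measure_pmf (kappa g \<psi>)) real"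
  using summable_divide[OF summable_real_weight[of g, OF g \<psi>], of "\<Sum>j. weight g \<psi> j"]
  by (simp add: integrable_pmf_nat_iff pmf_kappa[OF g \<psi>] mult.commute)

lemma density_of_eq:
  assumes g: "\<And>k. k \<ge> 1 \<Longrightarrow> g k > 0" and \<psi>: "\<psi> \<in> fugacities g"
  shows "density_of g \<psi> = (\<Sum>k. real k * weight g \<psi> k) / (\<Sum>j. weight g \<psi> j)"
  using integrable_kappa_real[OF g \<psi>] suminf_divide[OF summable_real_weight[of g, OF g \<psi>], of "\<Sum>j. weight g \<psi> j"]
  by (simp add: density_of_def integrable_pmf_nat_iff integral_pmf_nat pmf_kappa[OF g \<psi>] mult.commute)

text \<open>
  The ratio of the weights of \<open>kappa g \<phi>\<close> and \<open>kappa g \<psi>\<close> crosses \<open>1\<close> exactly once, from below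
  at some index \<open>m\<close>, so every term of \<open>\<Sum>k. (b k - a k) * (k - m)\<close> is nonnegative.
\<close>

lemma density_of_strict_mono:
  assumes g: "\<And>k. k \<ge> 1 \<Longrightarrow> g k > 0"
    and \<psi>: "\<psi> \<in> fugacities g" and \<phi>: "\<phi> \<in> fugacities g" and less: "\<psi> < \<phi>"
  shows "density_of g \<psi> < density_of g \<phi>"
proof -
  define a where "a = pmf (kappa g \<psi>)"
  define b where "b = pmf (kappa g \<phi>)"
  have \<psi>0: "0 \<le> \<psi>" using \<psi> by (simp add: fugacities_def)
  have a_Suc: "a (Suc k) = a k * \<psi> / g (Suc k)" for k
    by (simp add: a_def pmf_kappa[OF g \<psi>] weight_Suc)
  have b_Suc: "b (Suc k) = b k * \<phi> / g (Suc k)" for k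
    by (simp add: b_def pmf_kappa[OF g \<phi>] weight_Suc)
  have "a = (\<lambda>k. weight g \<psi> k / (\<Sum>j. weight g \<psi> j))" "b = (\<lambda>k. weight g \<phi> k / (\<Sum>j. weight g \<phi> j))"
    by (simp_all add: fun_eq_iff a_def b_def pmf_kappa[OF g \<psi>] pmf_kappa[OF g \<phi>])
  moreover have "(\<lambda>k. weight g \<psi> k / (\<Sum>j. weight g \<psi> j)) sums 1"
    "(\<lambda>k. weight g \<phi> k / (\<Sum>j. weight g \<phi> j)) sums 1"
    using sums_divide[OF summable_sums[OF summable_weight[of g, OF g \<psi>]], of "\<Sum>j. weight g \<psi> j"]
      sums_divide[OF summable_sums[OF summable_weight[of g, OF g \<phi>]], of "\<Sum>j. weight g \<phi> j"]
      partition_ge_1[OF g \<psi>] partition_ge_1[OF g \<phi>]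
    by simp_all
  ultimately have sa: "a sums 1" and sb: "b sums 1" by (simp_all only:)
  have sma: "summable (\<lambda>k. a k * real k)" and smb: "summable (\<lambda>k. b k * real k)"
    using integrable_kappa_real[OF g \<psi>] integrable_kappa_real[OF g \<phi>]
    by (simp_all add: integrable_pmf_nat_iff a_def b_def)
  have da: "(\<lambda>k. a k * real k) sums density_of g \<psi>"
    using summable_sums[OF sma] sma by (simp add: density_of_def integral_pmf_nat a_def)
  have db: "(\<lambda>k. b k * real k) sums density_of g \<phi>"
    using summable_sums[OF smb] smb by (simp add: density_of_def integral_pmf_nat b_def)
  have step: "a (Suc k) \<le> b (Suc k)" if "a k \<le> b k" for k
    unfolding a_Suc b_Suc using that less \<psi>0 g[of "Suc k"]
    by (intro divide_right_mono mult_mono) (auto simp: b_def)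
  \<comment> \<open>If \<open>a\<close> exceeded \<open>b\<close> everywhere, the two laws could not
    both have total mass one.\<close>
  have ex: "\<exists>k. a k \<le> b k"
  proof (rule ccontr)
    assume "\<not> (\<exists>k. a k \<le> b k)"
    then have *: "b k < a k" for k by (simp add: not_le)
    have S: "(\<lambda>k. a k - b k) sums 0" using sums_diff[OF sa sb] by simp
    then have "0 < (\<Sum>k. a k - b k)"
      using * by (intro suminf_pos) (auto simp: sums_iff)
    then show False using S by (simp add: sums_iff)
  qed
  define m where "m = (LEAST k. a k \<le> b k)"
  have below: "b k < a k" if "k < m" for k
    using not_less_Least that unfolding m_def by (meson not_le)
  have above: "a k \<le> b k" if "m \<le> k" for k
    using that by (induction k rule: dec_induct) (auto intro: step LeastI_ex[OF ex] simp: m_def)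
  \<comment> \<open>Both weights at 0 equal 1, so the claim compares the two partition functions;
    the term \<open>k = 1\<close> already makes them differ strictly. It yields \<open>m > 0\<close>
    and a strictly positive term in the final series.\<close>
  have "b 0 < a 0"
  proof -
    have "(\<Sum>k<1. weight g \<phi> k - weight g \<psi> k) + (weight g \<phi> 1 - weight g \<psi> 1)
        \<le> (\<Sum>k. weight g \<phi> k - weight g \<psi> k)"
    proof -
      have "(\<Sum>k<2. weight g \<phi> k - weight g \<psi> k) \<le> (\<Sum>k. weight g \<phi> k - weight g \<psi> k)"
      proof (intro sum_le_suminf summable_diff summable_weight g \<psi> \<phi>)
        show "0 \<le> weight g \<phi> n - weight g \<psi> n" for n
        proof -
          have "0 \<le> (\<Prod>i=1..n. g i)" using g by (intro prod_nonneg) (auto intro: less_imp_le)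
          moreover have "\<psi> ^ n \<le> \<phi> ^ n" using less \<psi>0 by (intro power_mono) auto
          ultimately show ?thesis unfolding weight_def by (simp add: divide_right_mono)
        qed
      qed auto
      then show ?thesis by (simp add: numeral_2_eq_2)
    qed
    moreover have "weight g \<phi> 1 - weight g \<psi> 1 > 0"
      using less g[of 1] by (simp add: weight_def divide_strict_right_mono)
    ultimately have "(\<Sum>k. weight g \<psi> k) < (\<Sum>k. weight g \<phi> k)"
      using suminf_diff[OF summable_weight[of g, OF g \<phi>] summable_weight[of g, OF g \<psi>]] by simp
    then show ?thesis using partition_ge_1[OF g \<psi>] partition_ge_1[OF g \<phi>]
      by (simp add: a_def b_def pmf_kappa[OF g \<psi>] pmf_kappa[OF g \<phi>] frac_less2)
  qed
  then have "m > 0" using above[of 0] by (cases m) auto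
  \<comment> \<open>Centring at \<open>m\<close> leaves the difference of the means unchanged,
    because both laws have mass one.\<close>
  have "(\<lambda>k. (b k * real k - a k * real k) - real m * (b k - a k)) sums
      ((density_of g \<phi> - density_of g \<psi>) - real m * (1 - 1))"
    by (intro sums_diff da db sums_mult sa sb)
  then have S: "(\<lambda>k. (b k - a k) * (real k - real m)) sums (density_of g \<phi> - density_of g \<psi>)"
    by (simp add: algebra_simps)
  have "0 < (\<Sum>k. (b k - a k) * (real k - real m))"
  proof (rule suminf_pos2)
    show "summable (\<lambda>k. (b k - a k) * (real k - real m))" using S by (simp add: sums_iff)
    show "0 \<le> (b k - a k) * (real k - real m)" for k
      using below[of k] above[of k]
      by (cases "k < m") (auto intro: mult_nonneg_nonneg mult_nonpos_nonpos)
    show "0 < (b 0 - a 0) * (real 0 - real m)"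
      using \<open>b 0 < a 0\<close> \<open>m > 0\<close> by (intro mult_neg_neg) auto
  qed
  then show ?thesis using S by (simp add: sums_iff)
qed

text \<open>Numerator and denominator are power series converging at some \<open>K\<close> beyond
  \<open>\<psi>\<close>. The quotient replaces \<open>density_of\<close> because the two are known
  to agree only on \<open>fugacities\<close>, whereas continuity at \<open>\<psi> = 0\<close> also
  involves negative arguments.\<close>

lemma isCont_density_of:
  assumes g: "\<And>k. k \<ge> 1 \<Longrightarrow> g k > 0" and \<psi>: "\<psi> \<in> fugacities g"
  shows "isCont (\<lambda>x. (\<Sum>k. real k * weight g x k) / (\<Sum>j. weight g x j)) \<psi>"
proof -
  obtain K where K: "K \<in> fugacities g" "\<psi> < K" using \<psi> by (rule fugacities_above)
  have n: "norm \<psi> < norm K" using K \<psi> by (simp add: fugacities_def)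
  have K_eq: "weight g K = (\<lambda>k. weight g 1 k * K ^ k)"
    by (rule ext) (rule weight_eq_powser)
  have "summable (\<lambda>k. real k * weight g 1 k * K ^ k)" "summable (\<lambda>k. weight g 1 k * K ^ k)"
    using summable_real_weight[of g, OF g K(1)] summable_weight[of g, OF g K(1)]
    unfolding K_eq by (simp_all only: mult.assoc)
  from isCont_powser[OF this(1) n] isCont_powser[OF this(2) n]
  have "isCont (\<lambda>x. \<Sum>k. real k * weight g x k) \<psi>" "isCont (\<lambda>x. \<Sum>k. weight g x k) \<psi>"
    unfolding weight_eq_powser[of g _ , symmetric] mult.assoc .
  then show ?thesis using partition_ge_1[OF g \<psi>] by (intro continuous_intros) auto
qed

text \<open>The intermediate value theorem applies between fugacity 0, where the density is 0, and a
  fugacity of density above \<open>\<rho>\<close>. Strict monotonicity makes the density injective,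
  so its inverse takes values in \<open>fugacities g\<close>.\<close>

lemma fugacity_of_mem:
  assumes g: "\<And>k. k \<ge> 1 \<Longrightarrow> g k > 0" and \<rho>: "0 \<le> \<rho>" "ereal \<rho> < crit_density g"
  shows "fugacity_of g \<rho> \<in> fugacities g"
proof -
  let ?c = "crit_fugacity g"
  have c0: "0 < ?c" using \<rho> by (auto simp: crit_density_def split: if_splits)
  have zero: "0 \<in> fugacities g" using c0 by (simp add: fugacities_def zero_ereal_def[symmetric])
  have real_mem: "real_of_ereal x \<in> fugacities g" if "0 \<le> x" "x < ?c" for x
    using that by (cases x) (auto simp: fugacities_def)
  \<comment> \<open>Otherwise the supremum \<open>S\<close> of all densities is at most
    \<open>\<rho>\<close>; by monotonicity \<open>S\<close> is also the left limit defining
    \<open>crit_density\<close>, a contradiction.\<close>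
  have "\<exists>\<phi>\<in>fugacities g. \<rho> < density_of g \<phi>"
  proof (rule ccontr)
    assume "\<not> (\<exists>\<phi>\<in>fugacities g. \<rho> < density_of g \<phi>)"
    then have le: "\<And>\<phi>. \<phi> \<in> fugacities g \<Longrightarrow> density_of g \<phi> \<le> \<rho>" by (meson not_less)
    define S where "S = (SUP \<phi>\<in>fugacities g. ereal (density_of g \<phi>))"
    have "((\<lambda>\<psi>. ereal (density_of g (real_of_ereal \<psi>))) \<longlongrightarrow> S) (at_left ?c)"
    proof (rule increasing_tendsto)
      have ev: "eventually (\<lambda>x. 0 \<le> x \<and> x < ?c) (at_left ?c)"
        unfolding eventually_at_left[OF c0] using c0 by (auto intro: less_imp_le)
      show "eventually (\<lambda>x. ereal (density_of g (real_of_ereal x)) \<le> S) (at_left ?c)"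
        using ev by eventually_elim (auto simp: S_def intro!: SUP_upper real_mem)
      fix y assume "y < S"
      then obtain \<phi> where \<phi>: "\<phi> \<in> fugacities g" "y < ereal (density_of g \<phi>)"
        unfolding S_def less_SUP_iff by blast
      then have "ereal \<phi> < ?c" "0 \<le> \<phi>" by (auto simp: fugacities_def)
      then have "eventually (\<lambda>x. ereal \<phi> < x \<and> x < ?c) (at_left ?c)"
        using eventually_at_left[of "ereal \<phi>" ?c] by auto
      then show "eventually (\<lambda>x. y < ereal (density_of g (real_of_ereal x))) (at_left ?c)"
      proof eventually_elim
        case (elim x)
        then have x: "real_of_ereal x \<in> fugacities g" using \<open>0 \<le> \<phi>\<close>
          by (intro real_mem) (auto intro: order_trans[of _ "ereal \<phi>"])
        have "\<phi> < real_of_ereal x" using elim \<open>0 \<le> \<phi>\<close> by (cases x) auto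
        then show ?case using density_of_strict_mono[OF g \<phi>(1) x] \<phi>(2)
          by (meson ereal_less_le less_ereal.simps(1) less_imp_le less_trans)
      qed
    qed
    \<comment> \<open>Convergence identifies the value of \<open>Lim\<close> only along a nontrivial
      filter.\<close>
    moreover have "at_left ?c \<noteq> bot"
    proof
      assume "at_left ?c = bot"
      then have "eventually (\<lambda>_. False) (at_left ?c)" by simp
      then show False using c0 dense by (metis eventually_at_left)
    qed
    ultimately have "Lim (at_left ?c) (\<lambda>\<psi>. ereal (density_of g (real_of_ereal \<psi>))) = S"
      by (intro tendsto_Lim)
    then have "crit_density g = S"
      unfolding crit_density_def using c0 by (auto dest: leD)
    moreover have "S \<le> ereal \<rho>" unfolding S_def by (intro SUP_least) (simp add: le)
    ultimately show False using \<rho> by simp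
  qed
  then obtain \<phi> where \<phi>: "\<phi> \<in> fugacities g" "\<rho> < density_of g \<phi>" by blast
  have sub: "x \<in> fugacities g" if "0 \<le> x" "x \<le> \<phi>" for x
    using that \<phi> order.strict_trans1[of "ereal x" "ereal \<phi>" "crit_fugacity g"]
    by (auto simp: fugacities_def)
  have "(\<lambda>k. real k * weight g 0 k) = (\<lambda>_. 0)" by (simp add: fun_eq_iff weight_def power_0_left)
  then have d0: "density_of g 0 = 0" by (simp add: density_of_eq[OF g zero])
  let ?D = "\<lambda>x. (\<Sum>k. real k * weight g x k) / (\<Sum>j. weight g x j)"
  have "\<exists>x. 0 \<le> x \<and> x \<le> \<phi> \<and> ?D x = \<rho>"
  proof (rule IVT)
    show "?D 0 \<le> \<rho>" using d0 \<rho>(1) by (simp only: density_of_eq[OF g zero])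
    show "\<rho> \<le> ?D \<phi>" using \<phi>(2) by (simp only: density_of_eq[OF g \<phi>(1)] less_imp_le)
    show "0 \<le> \<phi>" using \<phi> by (simp add: fugacities_def)
    show "\<forall>x. 0 \<le> x \<and> x \<le> \<phi> \<longrightarrow> isCont ?D x"
      using sub isCont_density_of[of g, OF g] by blast
  qed
  then obtain x where x: "x \<in> fugacities g" "density_of g x = \<rho>"
    using sub density_of_eq[of g, OF g] by force
  have "inj_on (density_of g) (fugacities g)"
    by (rule linorder_inj_onI') (metis density_of_strict_mono[of g, OF g] less_irrefl)
  with x show ?thesis unfolding fugacity_of_def by (auto intro: the_inv_into_into)
qed

section \<open>The weights \<open>\<beta>\<close> and the space \<open>\<Omega>'\<close>\<close>

text \<open>These finite sets come from an enumeration of the type and increase to everything. Being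
  indexed by natural numbers, they permit dominated convergence; they play the part of the boxes
  \<open>A\<close>.\<close>

definition enum_box :: "nat \<Rightarrow> 'a::countable set" where
  "enum_box n = {x. to_nat x < n}"

lemma finite_enum_box [simp]: "finite (enum_box n)"
  unfolding enum_box_def by (rule finite_imageD[of to_nat]) (auto intro: finite_subset[of _ "{..<n}"] inj_onI)

lemma eventually_mem_enum_box: "eventually (\<lambda>n. x \<in> enum_box n) sequentially"
  using eventually_gt_at_top[of "to_nat x"] by (simp add: enum_box_def)

lemma filterlim_enum_box: "filterlim enum_box (finite_subsets_at_top UNIV) sequentially"
  unfolding filterlim_finite_subsets_at_top
proof safe
  fix X :: "'a set" assume "finite X"
  then have "eventually (\<lambda>n. \<forall>x\<in>X. x \<in> enum_box n) sequentially"
    by (simp add: eventually_ball_finite_distrib eventually_mem_enum_box)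
  then show "\<forall>\<^sub>F n in sequentially. finite (enum_box n) \<and> X \<subseteq> enum_box n \<and> enum_box n \<subseteq> (UNIV :: 'a set)"
    by eventually_elim auto
qed

section \<open>Step probabilities and the total mass of \<open>beta\<close>\<close>

lemma nstep_translate: "nstep p n (x + z) = map_pmf (\<lambda>y. x + y) (nstep p n z)"
proof (induction n)
  case (Suc n)
  show ?case
    by (simp add: Suc map_bind_pmf bind_map_pmf map_pmf_comp add.assoc[abs_def])
qed simp

text \<open>\<open>beta\<close> varies the starting point, while a probability mass function is
  normalized over the endpoint; translation exchanges the two.\<close>

lemma pmf_nstep_0: "pmf (nstep p n x) 0 = pmf (nstep p n 0) (- x)"
proof -
  have "pmf (nstep p n (x + 0)) (x + - x) = pmf (nstep p n 0) (- x)"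
    unfolding nstep_translate by (rule pmf_map_inj') (simp add: inj_on_def)
  then show ?thesis by simp
qed

lemma summable_beta: "summable (\<lambda>n. (1/2) ^ n * pmf (nstep p n x) y)"
proof (rule summable_comparison_test')
  show "summable (\<lambda>n. (1/2::real) ^ n)" by (simp add: summable_geometric)
qed (simp add: pmf_le_1 mult_left_le)

lemma beta_nonneg [simp]: "0 \<le> beta p x"
  unfolding beta_def by (intro suminf_nonneg summable_beta) simp

lemma beta_0_ge_1: "1 \<le> beta p 0"
proof -
  have "(\<Sum>n<1. (1/2) ^ n * pmf (nstep p n 0) 0) \<le> beta p 0"
    unfolding beta_def by (intro sum_le_suminf summable_beta) auto
  then show ?thesis by simp
qed

text \<open>After reflection each step number \<open>n\<close> contributes total mass
  \<open>(1/2) ^ n\<close>, and the geometric series sums to 2.\<close>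

lemma nn_integral_beta: "(\<integral>\<^sup>+x. ennreal (beta p x) \<partial>count_space UNIV) = 2"
proof -
  have "(\<integral>\<^sup>+x. ennreal (beta p x) \<partial>count_space UNIV) =
      (\<integral>\<^sup>+x. (\<Sum>n. ennreal ((1/2) ^ n * pmf (nstep p n x) 0)) \<partial>count_space UNIV)"
    unfolding beta_def by (subst suminf_ennreal2) (simp_all add: summable_beta)
  also have "\<dots> = (\<Sum>n. \<integral>\<^sup>+x. ennreal ((1/2) ^ n * pmf (nstep p n x) 0) \<partial>count_space UNIV)"
    by (rule nn_integral_suminf) simp
  also have "\<dots> = (\<Sum>n. ennreal ((1/2) ^ n))"
  proof (rule suminf_cong)
    fix n
    have "(\<integral>\<^sup>+x. ennreal ((1/2) ^ n * pmf (nstep p n x) 0) \<partial>count_space UNIV) =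
        ennreal ((1/2) ^ n) * (\<integral>\<^sup>+x. ennreal (pmf (nstep p n 0) (- x)) \<partial>count_space UNIV)"
      by (subst nn_integral_cmult[symmetric]) (simp_all add: pmf_nstep_0[of p n] ennreal_mult)
    also have "(\<integral>\<^sup>+x. ennreal (pmf (nstep p n 0) (- x)) \<partial>count_space UNIV) =
        (\<integral>\<^sup>+x. ennreal (pmf (nstep p n 0) x) \<partial>count_space UNIV)"
      by (rule nn_integral_bij_count_space) (rule bij_uminus)
    finally show "(\<integral>\<^sup>+x. ennreal ((1/2) ^ n * pmf (nstep p n x) 0) \<partial>count_space UNIV) = ennreal ((1/2) ^ n)"
      by (simp add: nn_integral_pmf)
  qed
  also have "\<dots> = ennreal (\<Sum>n. (1/2) ^ n)"
    by (rule suminf_ennreal2) (simp_all add: summable_geometric)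
  finally show ?thesis by (simp add: suminf_geometric)
qed

lemma integrable_beta: "integrable (count_space UNIV) (beta p)"
  by (rule integrableI_nonneg) (simp_all add: nn_integral_beta)

section \<open>Finite configurations, the weighted distance and Lipschitz constants\<close>

lemma supported_mem_finite_configs:
  "finite A \<Longrightarrow> (\<And>x. x \<notin> A \<Longrightarrow> \<eta> x = 0) \<Longrightarrow> \<eta> \<in> finite_configs"
  unfolding finite_configs_def by (auto intro!: finite_subset[of _ A] dest: gr_implies_not0)

lemma finite_configs_subset_Omega': "finite_configs \<subseteq> Omega' (p :: ('d::finite) site pmf)"
proof
  fix \<eta> :: "('d::finite) config" assume "\<eta> \<in> finite_configs"
  then have "finite {x. \<eta> x \<noteq> 0}" by (simp add: finite_configs_def)
  then have "(\<lambda>x. real (\<eta> x) * beta p x) summable_on {x. \<eta> x \<noteq> 0}" by simp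
  then show "\<eta> \<in> Omega' p" unfolding Omega'_def mem_Collect_eq
    by (rule summable_on_cong_neutral[THEN iffD1, rotated -1]) auto
qed

text \<open>The value 0 outside \<open>A\<close> makes the truncation a genuine configuration and
  matches the default value of \<open>Pi_pmf A 0\<close>.\<close>

definition cutoff :: "'a set \<Rightarrow> ('a \<Rightarrow> nat) \<Rightarrow> 'a \<Rightarrow> nat" where
  "cutoff A \<eta> = (\<lambda>x. if x \<in> A then \<eta> x else 0)"

lemma cutoff_mem_finite_configs: "finite A \<Longrightarrow> cutoff A \<eta> \<in> finite_configs"
  unfolding finite_configs_def cutoff_def by (auto intro: finite_subset[of _ A])

lemma config_dist_fun_upd: "config_dist p (\<eta>(z := \<eta> z + 1)) \<eta> = beta p z"
proof -
  have "config_dist p (\<eta>(z := \<eta> z + 1)) \<eta> = (\<Sum>\<^sub>\<infinity>x\<in>{z}. beta p x)"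
    unfolding config_dist_def by (rule infsum_cong_neutral) auto
  then show ?thesis by simp
qed

lemma config_dist_nonneg: "0 \<le> config_dist p \<eta> \<zeta>"
  unfolding config_dist_def by (intro infsum_nonneg) auto

text \<open>The distance is the tail, outside the box, of the convergent series for the norm of
  \<open>\<eta>\<close>.\<close>

lemma config_dist_cutoff_tendsto:
  assumes "\<eta> \<in> Omega' p"
  shows "(\<lambda>n. config_dist p \<eta> (cutoff (enum_box n) \<eta>)) \<longlonglongrightarrow> 0"
proof -
  let ?w = "\<lambda>x. real (\<eta> x) * beta p x"
  have s: "?w summable_on UNIV" using assms by (simp add: Omega'_def)
  have eq: "config_dist p \<eta> (cutoff (enum_box n) \<eta>) = infsum ?w UNIV - sum ?w (enum_box n)" for n
  proof -
    have "config_dist p \<eta> (cutoff (enum_box n) \<eta>) = infsum ?w (UNIV - enum_box n)"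
      unfolding config_dist_def cutoff_def by (rule infsum_cong_neutral) auto
    also have "\<dots> = infsum ?w UNIV - infsum ?w (enum_box n)"
      by (rule infsum_Diff[OF s]) auto
    finally show ?thesis by simp
  qed
  have "(\<lambda>n. sum ?w (enum_box n)) \<longlonglongrightarrow> infsum ?w UNIV"
    using filterlim_compose[OF _ filterlim_enum_box] has_sum_infsum[OF s] unfolding has_sum_def by blast
  then have "(\<lambda>n. infsum ?w UNIV - sum ?w (enum_box n)) \<longlonglongrightarrow> infsum ?w UNIV - infsum ?w UNIV"
    by (intro tendsto_intros)
  then show ?thesis by (simp add: eq)
qed

text \<open>The bound is tested on the empty configuration and a single particle at the origin,
  whose distance \<open>beta p 0\<close> is at least 1.\<close>

lemma lip_bound_nonneg:
  assumes "lip_bound p c f"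
  shows "0 \<le> c"
proof -
  define \<delta> :: "'a config" where "\<delta> = (\<lambda>_. 0)(0 := 1)"
  have mem: "\<delta> \<in> Omega' p" "(\<lambda>_. 0) \<in> Omega' p"
    by (rule subsetD[OF finite_configs_subset_Omega'], simp add: finite_configs_def \<delta>_def)+
  have d: "config_dist p \<delta> (\<lambda>_. 0) = beta p 0"
    using config_dist_fun_upd[of p "\<lambda>_. 0" 0] by (simp add: \<delta>_def)
  have "\<bar>f \<delta> - f (\<lambda>_. 0)\<bar> \<le> c * beta p 0"
    using assms mem d by (force simp: lip_bound_def)
  then have "0 \<le> c * beta p 0" by linarith
  then show "0 \<le> c" using beta_0_ge_1[of p] by (simp add: zero_le_mult_iff)
qed

lemma lip_bound_lip_const:
  assumes "f \<in> lip_functions p"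
  shows "lip_bound p (lip_const p f) f"
  unfolding lip_bound_def
proof safe
  fix \<eta> \<zeta> assume m: "\<eta> \<in> Omega' p" "\<zeta> \<in> Omega' p"
  obtain c0 where c0: "lip_bound p c0 f" using assms by (auto simp: lip_functions_def)
  show "\<bar>f \<eta> - f \<zeta>\<bar> \<le> lip_const p f * config_dist p \<eta> \<zeta>"
  \<comment> \<open>At distance zero there is no difference quotient, but any admissible
    \<open>c0\<close> forces equal values. At positive distance the quotient is a lower bound of all
    admissible constants, hence of their infimum.\<close>
  proof (cases "config_dist p \<eta> \<zeta> = 0")
    case True
    then show ?thesis using c0 m by (force simp: lip_bound_def)
  next
    case False
    then have pos: "config_dist p \<eta> \<zeta> > 0" using config_dist_nonneg[of p \<eta> \<zeta>] by linarith
    have "\<bar>f \<eta> - f \<zeta>\<bar> / config_dist p \<eta> \<zeta> \<le> lip_const p f"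
      unfolding lip_const_def
    proof (rule cInf_greatest)
      show "{c. lip_bound p c f} \<noteq> {}" using c0 by auto
      fix c assume "c \<in> {c. lip_bound p c f}"
      then show "\<bar>f \<eta> - f \<zeta>\<bar> / config_dist p \<eta> \<zeta> \<le> c"
        using m pos by (simp add: lip_bound_def pos_divide_le_eq)
    qed
    then show ?thesis using pos by (simp add: pos_divide_le_eq)
  qed
qed

text \<open>The extended nonnegative integral makes sense for every configuration, which opens the
  way to measurability and to Tonelli's theorem.\<close>

lemma Omega'_eq:
  "Omega' p = {\<eta>. (\<integral>\<^sup>+x. ennreal (real (\<eta> x) * beta p x) \<partial>count_space UNIV) < \<infinity>}"
proof -
  have "(\<lambda>x. real (\<eta> x) * beta p x) summable_on UNIV \<longleftrightarrow>
      (\<integral>\<^sup>+x. ennreal (real (\<eta> x) * beta p x) \<partial>count_space UNIV) < \<infinity>" for \<eta>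
  proof -
    have "(\<lambda>x. real (\<eta> x) * beta p x) summable_on UNIV \<longleftrightarrow>
      Infinite_Set_Sum.abs_summable_on (\<lambda>x. real (\<eta> x) * beta p x) UNIV"
      unfolding abs_summable_equivalent[symmetric] by (rule summable_on_iff_abs_summable_on_real)
    then show ?thesis
      by (simp add: Infinite_Set_Sum.abs_summable_on_def integrable_iff_bounded)
  qed
  then show ?thesis by (simp add: Omega'_def)
qed

text \<open>Monotone convergence along \<open>enum_box\<close> writes the norm as a countable
  supremum of functions of finitely many coordinates.\<close>

lemma borel_measurable_config_norm:
  fixes p :: "('d::finite) site pmf"
  shows "(\<lambda>\<eta>. \<integral>\<^sup>+x. ennreal (real (\<eta> x) * beta p x) \<partial>count_space UNIV)
    \<in> borel_measurable (\<Pi>\<^sub>M x\<in>UNIV. count_space UNIV)"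
proof -
  have eq: "(\<lambda>\<eta>. \<integral>\<^sup>+x. ennreal (real (\<eta> x) * beta p x) \<partial>count_space UNIV) =
    (\<lambda>\<eta>::'d config. SUP n. \<Sum>x\<in>enum_box n. ennreal (real (\<eta> x) * beta p x))" (is "?l = ?r")
  proof
    fix \<eta> :: "'d config"
    let ?f = "\<lambda>x. ennreal (real (\<eta> x) * beta p x)"
    have "?l \<eta> = (\<integral>\<^sup>+x. (SUP n. ?f x * indicator (enum_box n) x) \<partial>count_space UNIV)"
    proof (rule nn_integral_cong)
      fix x :: "'d site"
      obtain n where n: "x \<in> enum_box n"
        using eventually_mem_enum_box[of x] by (auto simp: eventually_sequentially)
      show "?f x = (SUP n. ?f x * indicator (enum_box n) x)"
        by (rule antisym, rule SUP_upper2[of n])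
           (use n in \<open>auto intro!: SUP_least simp: indicator_def\<close>)
    qed
    also have "\<dots> = (SUP n. \<integral>\<^sup>+x. ?f x * indicator (enum_box n) x \<partial>count_space UNIV)"
      by (rule nn_integral_monotone_convergence_SUP)
         (auto simp: incseq_def le_fun_def enum_box_def indicator_def)
    also have "\<dots> = ?r \<eta>"
      by (simp add: nn_integral_count_space_indicator[symmetric] nn_integral_count_space_finite)
    finally show "?l \<eta> = ?r \<eta>" .
  qed
  show ?thesis unfolding eq by measurable
qed

lemma sets_Omega': "Omega' p \<in> sets (\<Pi>\<^sub>M x\<in>UNIV. count_space UNIV)"
proof -
  let ?M = "(\<Pi>\<^sub>M x\<in>UNIV. count_space UNIV) :: 'a config measure"
  note [measurable] = borel_measurable_config_norm[of p]
  have "{\<eta> \<in> space ?M. (\<integral>\<^sup>+x. ennreal (real (\<eta> x) * beta p x) \<partial>count_space UNIV) < \<infinity>} \<in> sets ?M"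
    by measurable
  then show ?thesis by (simp add: Omega'_eq space_PiM)
qed

section \<open>The chain on finite configurations\<close>

lemma integrable_measure_pmf_bounded:
  fixes f :: "'a \<Rightarrow> real"
  assumes "\<And>x. \<bar>f x\<bar> \<le> B"
  shows "integrable (measure_pmf q) f"
  by (rule measure_pmf.integrable_const_bound[where B=B]) (use assms in auto)

lemma abs_expectation_le:
  fixes f :: "'a \<Rightarrow> real"
  assumes "\<And>x. x \<in> set_pmf q \<Longrightarrow> \<bar>f x\<bar> \<le> B" "0 \<le> B"
  shows "\<bar>measure_pmf.expectation q f\<bar> \<le> B"
proof -
  have "integrable (measure_pmf q) f"
    by (rule measure_pmf.integrable_const_bound[where B=B]) (use assms in \<open>auto simp: AE_measure_pmf_iff\<close>)
  then have "\<bar>measure_pmf.expectation q f\<bar> \<le> measure_pmf.expectation q (\<lambda>x. \<bar>f x\<bar>)"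
    by (intro integral_abs_bound)
  also have "\<dots> \<le> measure_pmf.expectation q (\<lambda>x. B)"
    using \<open>integrable _ f\<close> assms by (intro integral_mono_AE) (auto simp: AE_measure_pmf_iff)
  finally show ?thesis by simp
qed

lemma expectation_eq_integral_count_space:
  fixes f :: "'a \<Rightarrow> real"
  shows "measure_pmf.expectation q f = (\<integral>x. pmf q x * f x \<partial>count_space UNIV)"
  by (simp add: measure_pmf_eq_density integral_density)

lemma integrable_pmf_mult_bounded:
  fixes f :: "'a \<Rightarrow> real"
  assumes "\<And>x. \<bar>f x\<bar> \<le> B"
  shows "integrable (count_space UNIV) (\<lambda>x. pmf q x * f x)"
proof (rule Bochner_Integration.integrable_bound)
  show "integrable (count_space UNIV) (\<lambda>x. B * pmf q x)" by (simp add: integrable_pmf)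
  have "pmf q x * \<bar>f x\<bar> \<le> \<bar>B\<bar> * pmf q x" for x
    using assms[of x] by (subst mult.commute) (auto intro!: mult_right_mono)
  then show "AE x in count_space UNIV. norm (pmf q x * f x) \<le> norm (B * pmf q x)"
    by (auto simp: abs_mult)
qed simp

lemma infsum_pmf_mult:
  fixes f :: "'a \<Rightarrow> real"
  assumes "\<And>x. \<bar>f x\<bar> \<le> B"
  shows "(\<lambda>x. norm (pmf q x * f x)) summable_on UNIV"
    and "(\<Sum>\<^sub>\<infinity>x. pmf q x * f x) = measure_pmf.expectation q f"
proof -
  have *: "Infinite_Set_Sum.abs_summable_on (\<lambda>x. pmf q x * f x) UNIV"
    using integrable_pmf_mult_bounded[of f B q, OF assms] by (simp add: Infinite_Set_Sum.abs_summable_on_def)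
  then show "(\<lambda>x. norm (pmf q x * f x)) summable_on UNIV" by (simp only: abs_summable_equivalent)
  show "(\<Sum>\<^sub>\<infinity>x. pmf q x * f x) = measure_pmf.expectation q f"
    using infsetsum_infsum[OF *] by (simp add: pmf_expectation_eq_infsetsum)
qed

text \<open>Rows outside \<open>A\<close> vanish because \<open>g 0 = 0\<close>, and boundedness of
  \<open>f\<close> makes each remaining row absolutely summable, so the unordered double sum may be
  iterated.\<close>

lemma zr_generator_eq:
  assumes "g 0 = 0" and A: "finite A" "\<And>x. x \<notin> A \<Longrightarrow> \<eta> x = 0" and f: "\<And>\<zeta>. \<bar>f \<zeta>\<bar> \<le> B"
  shows "zr_generator p g f \<eta> =
    (\<Sum>x\<in>A. g (\<eta> x) * (measure_pmf.expectation p (\<lambda>y. f (move \<eta> x (x + y))) - f \<eta>))"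
proof -
  let ?F = "\<lambda>(x, y). pmf p y * (g (\<eta> x) * (f (move \<eta> x (x + y)) - f \<eta>))"
  have bd: "\<bar>g (\<eta> x) * (f (move \<eta> x (x + y)) - f \<eta>)\<bar> \<le> \<bar>g (\<eta> x)\<bar> * (B + B)" for x y
    using abs_triangle_ineq4[of "f (move \<eta> x (x + y))" "f \<eta>"] f[of \<eta>] f[of "move \<eta> x (x + y)"]
    by (auto simp: abs_mult intro!: mult_left_mono)
  have row: "(\<lambda>y. norm (?F (x, y))) summable_on UNIV" for x
    unfolding prod.case by (rule infsum_pmf_mult(1)) (rule bd)
  have "(\<lambda>z. norm (?F z)) summable_on (A \<times> UNIV)"
    unfolding Infinite_Sum.abs_summable_on_Sigma_iff by (intro conjI ballI row summable_on_finite[OF A(1)])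
  then have s: "?F summable_on (A \<times> UNIV)" by (rule abs_summable_summable)
  have "x \<in> A" if "g (\<eta> x) \<noteq> 0" for x using A(2)[of x] \<open>g 0 = 0\<close> that by metis
  then have "zr_generator p g f \<eta> = infsum ?F (A \<times> UNIV)"
    unfolding zr_generator_def by (intro infsum_cong_neutral) auto
  also have "\<dots> = (\<Sum>\<^sub>\<infinity>x\<in>A. \<Sum>\<^sub>\<infinity>y. pmf p y * (g (\<eta> x) * (f (move \<eta> x (x + y)) - f \<eta>)))"
    using infsum_Sigma'_banach[OF s] by simp
  also have "\<dots> = (\<Sum>x\<in>A. measure_pmf.expectation p (\<lambda>y. g (\<eta> x) * (f (move \<eta> x (x + y)) - f \<eta>)))"
    using A(1) by (simp add: infsum_pmf_mult(2)[OF bd])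
  also have "\<dots> = (\<Sum>x\<in>A. g (\<eta> x) * (measure_pmf.expectation p (\<lambda>y. f (move \<eta> x (x + y))) - f \<eta>))"
    by (intro sum.cong refl) (simp add: integrable_measure_pmf_bounded[OF f])
  finally show ?thesis .
qed

lemma zr_chain_right_derivative:
  assumes K: "zr_chain p g K" and f: "\<And>\<zeta>. \<bar>f \<zeta>\<bar> \<le> B" and \<eta>: "\<eta> \<in> finite_configs"
  shows "((\<lambda>s. (measure_pmf.expectation (K s \<eta>) f - f \<eta>) / s) \<longlongrightarrow> zr_generator p g f \<eta>) (at_right 0)"
proof -
  have "bounded (range f)" by (rule boundedI[of _ B]) (use f in auto)
  then have "((\<lambda>t. measure_pmf.expectation (K t \<eta>) f) has_real_derivative zr_generator p g f \<eta>) (at_right 0)"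
    using K \<eta> unfolding zr_chain_def by blast
  moreover have "measure_pmf.expectation (K 0 \<eta>) f = f \<eta>"
    using K \<eta> by (simp add: zr_chain_def)
  ultimately show ?thesis by (simp add: has_field_derivative_iff)
qed

text \<open>
  The return probability \<open>v s = P(\<eta>\<^sub>s = \<eta>)\<close> is supermultiplicative, so Bernoulli's inequality gives
  \<open>v s \<ge> v (s/n)\<^sup>n \<ge> 1 - n (1 - v (s/n))\<close>, and the right-hand side tends to \<open>1 - s q\<close> for the total
  jump rate \<open>q\<close>.
\<close>

lemma zr_chain_stay:
  fixes \<eta> :: "('d::finite) config"
  assumes g0: "g 0 = 0" and gnn: "\<And>k. 0 \<le> g k" and K: "zr_chain p g K"
    and A: "finite A" "\<And>x. x \<notin> A \<Longrightarrow> \<eta> x = 0" and s: "0 \<le> s"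
  shows "1 - pmf (K s \<eta>) \<eta> \<le> s * (\<Sum>x\<in>A. g (\<eta> x))"
proof (cases "s = 0")
  case True
  have \<eta>: "\<eta> \<in> finite_configs"
    using A by (rule supported_mem_finite_configs)
  then show ?thesis using K True by (simp add: zr_chain_def)
next
  case False
  then have s: "0 < s" using s by simp
  have \<eta>: "\<eta> \<in> finite_configs"
    using A by (rule supported_mem_finite_configs)
  define v where "v t = pmf (K t \<eta>) \<eta>" for t
  let ?I = "indicat_real {\<eta>}"
  define q where "q = - zr_generator p g ?I \<eta>"
  have I1: "\<bar>?I \<zeta>\<bar> \<le> 1" for \<zeta> :: "'d config" by (simp add: indicator_def)
  have v_eq: "measure_pmf.expectation (K t \<eta>) ?I = v t" for t
    by (simp add: v_def measure_pmf_single)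
  have v0: "v 0 = 1" using K \<eta> by (simp add: zr_chain_def v_def)
  \<comment> \<open>The semigroup property is applied, keeping only the paths that are at
    \<open>\<eta>\<close> at the intermediate time \<open>t\<close>.\<close>
  have supermult: "v t * v u \<le> v (t + u)" if "0 \<le> t" "0 \<le> u" for t u
  proof -
    have "v (t + u) = measure_pmf.expectation (K t \<eta>) (\<lambda>\<zeta>. pmf (K u \<zeta>) \<eta>)"
      using K \<eta> that by (simp add: zr_chain_def v_def pmf_bind)
    also have "\<dots> \<ge> measure_pmf.expectation (K t \<eta>) (\<lambda>\<zeta>. ?I \<zeta> * v u)"
    proof (rule integral_mono)
      show "integrable (K t \<eta>) (\<lambda>\<zeta>. ?I \<zeta> * v u)"
        by (rule integrable_measure_pmf_bounded[of _ "1"]) (simp add: indicator_def v_def pmf_le_1)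
      show "integrable (K t \<eta>) (\<lambda>\<zeta>. pmf (K u \<zeta>) \<eta>)"
        by (rule integrable_measure_pmf_bounded[of _ "1"]) (simp add: pmf_le_1)
    qed (simp add: indicator_def v_def)
    finally show ?thesis using v_eq by simp
  qed
  have pow: "v t ^ n \<le> v (real n * t)" if "0 \<le> t" for t n
  proof (induction n)
    case (Suc n)
    have "v t ^ Suc n \<le> v t * v (real n * t)"
      using Suc by (simp add: mult_left_mono v_def)
    also have "\<dots> \<le> v (t + real n * t)" using that by (intro supermult) auto
    finally show ?case by (simp add: algebra_simps)
  qed (simp add: v0)
  have lower: "1 - real n * (1 - v (s / real n)) \<le> v s" if "n > 0" for n
  proof -
    have "1 + real n * (v (s / real n) - 1) \<le> (1 + (v (s / real n) - 1)) ^ n"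
      by (rule Bernoulli_inequality) (simp add: v_def)
    also have "\<dots> \<le> v s" using pow[of "s / real n" n] s that by simp
    finally show ?thesis by (simp add: algebra_simps)
  qed
  have lim: "((\<lambda>t. (v t - 1) / t) \<longlongrightarrow> - q) (at_right 0)"
    using zr_chain_right_derivative[where f = ?I, OF K I1 \<eta>] by (simp add: v_def q_def measure_pmf_single)
  have "filterlim (\<lambda>n. s / real n) (at_right 0) sequentially"
  proof (rule tendsto_imp_filterlim_at_right)
    show "(\<lambda>n. s / real n) \<longlonglongrightarrow> 0" by (rule lim_const_over_n)
    show "eventually (\<lambda>n. s / real n > 0) sequentially"
      using eventually_gt_at_top[of 0] by eventually_elim (use s in simp)
  qed
  from filterlim_compose[OF lim this]
  have "(\<lambda>n. 1 + s * ((v (s / real n) - 1) / (s / real n))) \<longlonglongrightarrow> 1 + s * (- q)"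
    by (intro tendsto_intros)
  moreover have "eventually (\<lambda>n. 1 + s * ((v (s / real n) - 1) / (s / real n)) \<le> v s) sequentially"
    using eventually_gt_at_top[of 0]
  proof eventually_elim
    case (elim n)
    have "s * (w / (s / real n)) = real n * w" for w using s by simp
    then show ?case using lower[OF elim] by (simp only: right_diff_distrib)
  qed
  ultimately have "1 + s * (- q) \<le> v s"
    by (intro tendsto_upperbound[where F = sequentially]) auto
  \<comment> \<open>Only an inequality holds in general, because \<open>p\<close> may charge 0 and
    such a jump does not leave \<open>\<eta>\<close>.\<close>
  moreover have "q \<le> (\<Sum>x\<in>A. g (\<eta> x))"
  proof -
    have "zr_generator p g ?I \<eta> =
        (\<Sum>x\<in>A. g (\<eta> x) * (measure_pmf.expectation p (\<lambda>y. ?I (move \<eta> x (x + y))) - ?I \<eta>))"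
      using g0 A I1 by (rule zr_generator_eq)
    then have "q = (\<Sum>x\<in>A. g (\<eta> x) * (1 - measure_pmf.expectation p (\<lambda>y. ?I (move \<eta> x (x + y)))))"
      by (simp add: q_def sum_negf[symmetric] right_diff_distrib)
    also have "\<dots> \<le> (\<Sum>x\<in>A. g (\<eta> x) * 1)"
      by (intro sum_mono mult_left_mono gnn) (auto intro!: integral_nonneg)
    finally show ?thesis by simp
  qed
  then have "s * q \<le> s * (\<Sum>x\<in>A. g (\<eta> x))" using s by (intro mult_left_mono) auto
  ultimately show ?thesis by (simp add: v_def)
qed

text \<open>The integrand \<open>f \<zeta> - f \<eta>\<close> vanishes at \<open>\<eta>\<close> and
  is at most \<open>2 * B\<close> elsewhere, so the probability of being away from
  \<open>\<eta>\<close> controls it. The bound is linear in \<open>s\<close>, and later dominates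
  the difference quotients.\<close>

lemma zr_chain_increment:
  fixes \<eta> :: "('d::finite) config"
  assumes g0: "g 0 = 0" and gnn: "\<And>k. 0 \<le> g k" and K: "zr_chain p g K"
    and A: "finite A" "\<And>x. x \<notin> A \<Longrightarrow> \<eta> x = 0" and s: "0 \<le> s" and f: "\<And>\<zeta>. \<bar>f \<zeta>\<bar> \<le> B"
  shows "\<bar>measure_pmf.expectation (K s \<eta>) f - f \<eta>\<bar> \<le> 2 * B * (s * (\<Sum>x\<in>A. g (\<eta> x)))"
proof -
  have "0 \<le> B" using f[of \<eta>] by linarith
  have int: "integrable (K s \<eta>) f" by (rule integrable_measure_pmf_bounded[OF f])
  have intI: "integrable (K s \<eta>) (indicat_real (- {\<eta>}))"
    by (rule integrable_measure_pmf_bounded[of _ 1]) (simp add: indicator_def)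
  have "\<bar>measure_pmf.expectation (K s \<eta>) f - f \<eta>\<bar> = \<bar>measure_pmf.expectation (K s \<eta>) (\<lambda>\<zeta>. f \<zeta> - f \<eta>)\<bar>"
    using int by simp
  also have "\<dots> \<le> measure_pmf.expectation (K s \<eta>) (\<lambda>\<zeta>. 2 * B * indicat_real (- {\<eta>}) \<zeta>)"
  proof (rule order_trans[OF integral_abs_bound], rule integral_mono)
    fix \<zeta>
    show "\<bar>f \<zeta> - f \<eta>\<bar> \<le> 2 * B * indicat_real (- {\<eta>}) \<zeta>"
      using f[of \<zeta>] f[of \<eta>] by (auto simp: indicator_def)
  qed (use int intI in auto)
  also have "\<dots> = 2 * B * measure (K s \<eta>) (- {\<eta>})" by simp
  also have "measure (K s \<eta>) (- {\<eta>}) = 1 - pmf (K s \<eta>) \<eta>"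
    using measure_pmf.prob_compl[of "{\<eta>}" "K s \<eta>"] by (simp add: measure_pmf_single Compl_eq_Diff_UNIV)
  also have "2 * B * (1 - pmf (K s \<eta>) \<eta>) \<le> 2 * B * (s * (\<Sum>x\<in>A. g (\<eta> x)))"
    using \<open>0 \<le> B\<close> by (intro mult_left_mono zr_chain_stay[OF g0 gnn K A s]) auto
  finally show ?thesis .
qed

section \<open>The generator under product laws on finite boxes\<close>

lemma pmf_Pi_pmf_shift:
  assumes "finite A" "x \<in> A" and shift: "\<And>k. pmf q (Suc k) * g (Suc k) = \<psi> * pmf q k"
  shows "pmf (Pi_pmf A 0 (\<lambda>_. q)) (\<zeta>(x := \<zeta> x + 1)) * g (\<zeta> x + 1) = \<psi> * pmf (Pi_pmf A 0 (\<lambda>_. q)) \<zeta>"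
proof -
  have 1: "(\<Prod>y\<in>A. pmf q ((\<zeta>(x := \<zeta> x + 1)) y)) = pmf q (Suc (\<zeta> x)) * (\<Prod>y\<in>A - {x}. pmf q (\<zeta> y))"
    using assms(1,2) by (subst prod.remove[of A x]) (auto intro!: prod.cong)
  have 2: "(\<Prod>y\<in>A. pmf q (\<zeta> y)) = pmf q (\<zeta> x) * (\<Prod>y\<in>A - {x}. pmf q (\<zeta> y))"
    using assms(1,2) by (rule prod.remove)
  have 3: "(\<forall>y. y \<notin> A \<longrightarrow> (\<zeta>(x := \<zeta> x + 1)) y = 0) \<longleftrightarrow> (\<forall>y. y \<notin> A \<longrightarrow> \<zeta> y = 0)"
    using \<open>x \<in> A\<close> by auto
  show ?thesis
    using shift[of "\<zeta> x"] unfolding pmf_Pi[OF \<open>finite A\<close>] 1 2 3 by (auto simp: algebra_simps)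
qed

text \<open>Adding a particle at \<open>x\<close> is a bijection onto the configurations occupied at
  \<open>x\<close>; the others drop out since \<open>g 0 = 0\<close>. The change of variables trades
  the rate for the factor \<open>\<psi>\<close>.\<close>

lemma expectation_Pi_pmf_shift:
  fixes G :: "('a \<Rightarrow> nat) \<Rightarrow> real"
  assumes "finite A" "x \<in> A" "g 0 = 0" and shift: "\<And>k. pmf q (Suc k) * g (Suc k) = \<psi> * pmf q k"
  shows "measure_pmf.expectation (Pi_pmf A 0 (\<lambda>_. q)) (\<lambda>\<eta>. g (\<eta> x) * G \<eta>) =
    \<psi> * measure_pmf.expectation (Pi_pmf A 0 (\<lambda>_. q)) (\<lambda>\<eta>. G (\<eta>(x := \<eta> x + 1)))"
proof -
  let ?\<pi> = "Pi_pmf A 0 (\<lambda>_. q)"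
  let ?S = "{\<eta>. \<eta> x \<noteq> 0} :: ('a \<Rightarrow> nat) set"
  have bij: "bij_betw (\<lambda>\<eta>. \<eta>(x := \<eta> x + 1)) UNIV ?S"
    by (rule bij_betwI[where g = "\<lambda>\<eta>. \<eta>(x := \<eta> x - 1)"]) auto
  have "measure_pmf.expectation ?\<pi> (\<lambda>\<eta>. g (\<eta> x) * G \<eta>) =
      (\<integral>\<eta>. indicator ?S \<eta> *\<^sub>R (pmf ?\<pi> \<eta> * (g (\<eta> x) * G \<eta>)) \<partial>count_space UNIV)"
    unfolding expectation_eq_integral_count_space
    by (intro Bochner_Integration.integral_cong) (auto simp: indicator_def \<open>g 0 = 0\<close>)
  also have "\<dots> = (\<integral>\<eta>. pmf ?\<pi> \<eta> * (g (\<eta> x) * G \<eta>) \<partial>count_space ?S)"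
    by (subst integral_restrict_space[symmetric]) (simp_all add: restrict_count_space)
  also have "\<dots> = (\<integral>\<eta>. pmf ?\<pi> (\<eta>(x := \<eta> x + 1)) * (g (\<eta> x + 1) * G (\<eta>(x := \<eta> x + 1))) \<partial>count_space UNIV)"
    by (subst integral_bij_count_space[OF bij, symmetric]) simp
  also have "\<dots> = (\<integral>\<eta>. \<psi> * (pmf ?\<pi> \<eta> * G (\<eta>(x := \<eta> x + 1))) \<partial>count_space UNIV)"
    using pmf_Pi_pmf_shift[OF assms(1,2) shift]
    by (intro Bochner_Integration.integral_cong refl) (simp add: mult.assoc[symmetric])
  finally show ?thesis unfolding expectation_eq_integral_count_space by simp
qed

text \<open>When every site of \<open>A\<close> sends out unit mass, the inner difference is the
  mass arriving at \<open>z\<close> minus the mass that was there. The factor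
  \<open>beta p z\<close> is the distance caused by one particle at \<open>z\<close>.\<close>

definition boundary_flux :: "('d::finite) site pmf \<Rightarrow> 'd site set \<Rightarrow> real" where
  "boundary_flux p A =
     (\<integral>z. beta p z * \<bar>(\<Sum>x\<in>A. pmf p (z - x)) - indicator A z\<bar> \<partial>count_space UNIV)"

text \<open>Reading a column sum of the transition matrix as a probability gives its bound by 1 and
  its convergence to 1 as \<open>A\<close> grows.\<close>

lemma sum_pmf_diff:
  fixes z :: "'a::ab_group_add"
  assumes "finite A"
  shows "(\<Sum>x\<in>A. pmf p (z - x)) = measure p ((\<lambda>x. z - x) ` A)"
proof -
  have "inj_on (\<lambda>x. z - x) A" by (simp add: inj_on_def)
  with assms show ?thesis by (simp add: measure_measure_pmf_finite sum.reindex)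
qed

lemma sum_pmf_diff_bounds:
  fixes z :: "'a::ab_group_add"
  assumes "finite A"
  shows "0 \<le> (\<Sum>x\<in>A. pmf p (z - x))" "(\<Sum>x\<in>A. pmf p (z - x)) \<le> 1"
  by (simp_all add: sum_pmf_diff[OF assms])

lemma boundary_flux_bound:
  fixes p :: "('d::finite) site pmf"
  assumes "finite A"
  shows "norm (beta p z * \<bar>(\<Sum>x\<in>A. pmf p (z - x)) - indicator A z\<bar>) \<le> beta p z"
proof -
  have "\<bar>(\<Sum>x\<in>A. pmf p (z - x)) - indicator A z\<bar> \<le> 1"
    using sum_pmf_diff_bounds[OF assms, of p z] by (auto simp: indicator_def)
  then show ?thesis by (simp add: abs_mult mult_left_le)
qed

text \<open>At each fixed \<open>z\<close> the column sum and the indicator both tend to 1, and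
  \<open>beta p\<close> is an integrable majorant.\<close>

lemma boundary_flux_tendsto: "(\<lambda>n. boundary_flux p (enum_box n)) \<longlonglongrightarrow> 0"
proof -
  have "(\<lambda>n. boundary_flux p (enum_box n)) \<longlonglongrightarrow> (\<integral>z. 0 \<partial>count_space (UNIV :: 'a site set))"
    unfolding boundary_flux_def
  proof (rule integral_dominated_convergence[where w = "beta p"])
    have "(\<lambda>n. beta p z * \<bar>(\<Sum>x\<in>enum_box n. pmf p (z - x)) - indicator (enum_box n) z\<bar>) \<longlonglongrightarrow>
        beta p z * \<bar>1 - 1\<bar>" for z
    proof (intro tendsto_intros)
      have "(\<lambda>n. measure p ((\<lambda>x. z - x) ` enum_box n)) \<longlonglongrightarrow> measure p (\<Union>n. (\<lambda>x. z - x) ` enum_box n)"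
        by (rule measure_pmf.finite_Lim_measure_incseq) (auto simp: incseq_def enum_box_def)
      moreover have "(\<Union>n. (\<lambda>x. z - x) ` enum_box n) = UNIV"
      proof safe
        fix y :: "'a site"
        obtain n where "z - y \<in> enum_box n"
          using eventually_mem_enum_box[of "z - y"] by (auto simp: eventually_sequentially)
        then show "y \<in> (\<Union>n. (\<lambda>x. z - x) ` enum_box n)" by (auto intro!: exI[of _ n] rev_image_eqI)
      qed auto
      ultimately show "(\<lambda>n. \<Sum>x\<in>enum_box n. pmf p (z - x)) \<longlonglongrightarrow> 1"
        using measure_pmf.prob_space[of p] by (simp add: sum_pmf_diff)
      show "(\<lambda>n. indicat_real (enum_box n) z) \<longlonglongrightarrow> 1"
        by (rule tendsto_eventually, rule eventually_mono[OF eventually_mem_enum_box[of z]]) simp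
    qed
    then show "AE z in count_space UNIV.
        (\<lambda>n. beta p z * \<bar>(\<Sum>x\<in>enum_box n. pmf p (z - x)) - indicator (enum_box n) z\<bar>) \<longlonglongrightarrow> 0"
      by simp
    show "AE z in count_space UNIV.
        norm (beta p z * \<bar>(\<Sum>x\<in>enum_box n. pmf p (z - x)) - indicator (enum_box n) z\<bar>) \<le> beta p z" for n
      using boundary_flux_bound[of "enum_box n" p] by simp
  qed (simp_all add: integrable_beta)
  then show ?thesis by simp
qed

text \<open>
  Resummation over the target site \<open>z = x + y\<close>: since \<open>p\<close> is doubly stochastic on the whole
  lattice, only sites whose jumps cross the boundary of \<open>A\<close> contribute.
\<close>

lemma sum_expectation_increment_le:
  fixes p :: "('d::finite) site pmf"
  assumes A: "finite A" and k: "\<And>z. \<bar>k z\<bar> \<le> c * beta p z"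
  shows "\<bar>\<Sum>x\<in>A. measure_pmf.expectation p (\<lambda>y. k (x + y)) - k x\<bar> \<le> c * boundary_flux p A"
proof -
  let ?N = "count_space (UNIV :: 'd site set)"
  have ik: "integrable ?N k"
    by (rule Bochner_Integration.integrable_bound[of _ "\<lambda>z. c * beta p z"])
       (auto simp: integrable_beta simp del: abs_mult intro: order_trans[OF k abs_ge_self])
  have ikp: "integrable ?N (\<lambda>z. pmf p (z - x) * k z)" for x
    by (rule Bochner_Integration.integrable_bound[OF ik])
       (auto simp: abs_mult pmf_le_1 intro!: mult_left_le_one_le)
  have iki: "integrable ?N (\<lambda>z. indicator {x} z * k z)" for x
    by (rule Bochner_Integration.integrable_bound[OF ik]) (auto simp: indicator_def)
  have 1: "measure_pmf.expectation p (\<lambda>y. k (x + y)) = (\<integral>z. pmf p (z - x) * k z \<partial>?N)" for x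
  proof -
    have "bij_betw (\<lambda>z. z - x) UNIV UNIV"
      by (rule bij_betwI[where g = "\<lambda>z. z + x"]) auto
    from integral_bij_count_space[OF this, of "\<lambda>y. pmf p y * k (x + y)"]
    show ?thesis by (simp add: expectation_eq_integral_count_space)
  qed
  have 2: "k x = (\<integral>z. indicator {x} z * k z \<partial>?N)" for x
    by (cases "k x = 0"; subst lebesgue_integral_count_space_finite_support)
       (auto simp: indicator_def intro: finite_subset[of _ "{x}"] split: if_splits)
  have "(\<Sum>x\<in>A. measure_pmf.expectation p (\<lambda>y. k (x + y)) - k x) =
      (\<Sum>x\<in>A. \<integral>z. pmf p (z - x) * k z - indicator {x} z * k z \<partial>?N)"
    by (intro sum.cong refl) (simp add: 1 2[symmetric] ikp iki)
  also have "\<dots> = (\<integral>z. (\<Sum>x\<in>A. pmf p (z - x) * k z - indicator {x} z * k z) \<partial>?N)"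
    by (rule Bochner_Integration.integral_sum[symmetric]) (intro Bochner_Integration.integrable_diff ikp iki)
  also have "\<dots> = (\<integral>z. k z * ((\<Sum>x\<in>A. pmf p (z - x)) - indicator A z) \<partial>?N)"
  proof (intro Bochner_Integration.integral_cong refl)
    fix z
    have "(\<Sum>x\<in>A. indicator {x} z) = (indicator A z :: real)"
      using A by (simp add: indicator_def)
    then show "(\<Sum>x\<in>A. pmf p (z - x) * k z - indicator {x} z * k z) =
        k z * ((\<Sum>x\<in>A. pmf p (z - x)) - indicator A z)"
      by (simp only: sum_subtractf flip: sum_distrib_right) (simp add: algebra_simps)
  qed
  also have "\<bar>\<dots>\<bar> \<le> (\<integral>z. \<bar>k z * ((\<Sum>x\<in>A. pmf p (z - x)) - indicator A z)\<bar> \<partial>?N)"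
    by (rule integral_abs_bound)
  also have "\<dots> \<le> (\<integral>z. c * (beta p z * \<bar>(\<Sum>x\<in>A. pmf p (z - x)) - indicator A z\<bar>) \<partial>?N)"
  proof (rule integral_mono)
    have i: "integrable ?N (\<lambda>z. beta p z * \<bar>(\<Sum>x\<in>A. pmf p (z - x)) - indicator A z\<bar>)"
      by (rule Bochner_Integration.integrable_bound[OF integrable_beta[of p]])
         (use boundary_flux_bound[OF A, of p] in auto)
    then show "integrable ?N (\<lambda>z. c * (beta p z * \<bar>(\<Sum>x\<in>A. pmf p (z - x)) - indicator A z\<bar>))" by simp
    show le: "\<bar>k z * ((\<Sum>x\<in>A. pmf p (z - x)) - indicator A z)\<bar> \<le>
        c * (beta p z * \<bar>(\<Sum>x\<in>A. pmf p (z - x)) - indicator A z\<bar>)" for z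
      using mult_right_mono[OF k[of z], of "\<bar>(\<Sum>x\<in>A. pmf p (z - x)) - indicator A z\<bar>"]
      by (simp add: abs_mult mult.assoc)
    show "integrable ?N (\<lambda>z. \<bar>k z * ((\<Sum>x\<in>A. pmf p (z - x)) - indicator A z)\<bar>)"
      by (rule Bochner_Integration.integrable_bound[of _ "\<lambda>z. c * (beta p z * \<bar>(\<Sum>x\<in>A. pmf p (z - x)) - indicator A z\<bar>)"])
         (use i in \<open>auto simp del: abs_mult intro: order_trans[OF le abs_ge_self]\<close>)
  qed
  finally show ?thesis by (simp add: boundary_flux_def)
qed

lemma integrable_Pi_pmf_component:
  fixes g :: "nat \<Rightarrow> real"
  assumes "finite A" "x \<in> A" "integrable (measure_pmf q) g"
  shows "integrable (measure_pmf (Pi_pmf A 0 (\<lambda>_. q))) (\<lambda>\<eta>. g (\<eta> x))"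
  using assms integrable_map_pmf_eq[of "\<lambda>\<eta>. \<eta> x" "Pi_pmf A 0 (\<lambda>_. q)" g]
  by (simp add: Pi_pmf_component)

text \<open>The particle added by the change of variables is the one that jumps, so the truncated
  subtraction in \<open>move\<close> is exact here.\<close>

lemma move_add: "move (\<eta>(x := \<eta> x + 1)) x z = \<eta>(z := \<eta> z + 1)"
  by (auto simp: move_def Let_def)

text \<open>After the change of variables only the increments \<open>k \<eta>\<close> of
  \<open>h\<close> remain, and the resummed bound holds for each \<open>\<eta>\<close> in the
  support before averaging.\<close>

lemma expectation_generator_le:
  fixes p :: "('d::finite) site pmf"
  assumes A: "finite A" and g0: "g 0 = 0"
    and shift: "\<And>k. pmf q (Suc k) * g (Suc k) = \<psi> * pmf q k" and "0 \<le> \<psi>"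
    and ig: "integrable (measure_pmf q) g"
    and h: "\<And>\<zeta>. \<bar>h \<zeta>\<bar> \<le> B"
    and lip: "\<And>\<zeta> z. \<zeta> \<in> finite_configs \<Longrightarrow> \<bar>h (\<zeta>(z := \<zeta> z + 1)) - h \<zeta>\<bar> \<le> c * beta p z" and "0 \<le> c"
  shows "\<bar>measure_pmf.expectation (Pi_pmf A 0 (\<lambda>_. q))
      (\<lambda>\<eta>. \<Sum>x\<in>A. g (\<eta> x) * (measure_pmf.expectation p (\<lambda>y. h (move \<eta> x (x + y))) - h \<eta>))\<bar>
    \<le> \<psi> * (c * boundary_flux p A)"
proof -
  let ?\<pi> = "Pi_pmf A 0 (\<lambda>_. q)"
  define k where "k \<eta> z = h (\<eta>(z := \<eta> z + 1)) - h \<eta>" for \<eta> :: "'d config" and z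
  have B: "0 \<le> B" using h[of undefined] by linarith
  have kB: "\<bar>k \<eta> z\<bar> \<le> 2 * B" for \<eta> z
    using h[of \<eta>] h[of "\<eta>(z := \<eta> z + 1)"] by (simp add: k_def)
  have int: "integrable ?\<pi> (\<lambda>\<eta>. g (\<eta> x) * (measure_pmf.expectation p (\<lambda>y. h (move \<eta> x (x + y))) - h \<eta>))"
    if "x \<in> A" for x
  proof (rule Bochner_Integration.integrable_bound)
    show "integrable ?\<pi> (\<lambda>\<eta>. (2 * B) * g (\<eta> x))"
      using integrable_Pi_pmf_component[OF A that ig] by simp
    have "\<bar>measure_pmf.expectation p (\<lambda>y. h (move \<eta> x (x + y))) - h \<eta>\<bar> \<le> 2 * B" for \<eta>
      using abs_expectation_le[of p "\<lambda>y. h (move \<eta> x (x + y))" B] h B h[of \<eta>] by (smt (verit))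
    then show "AE \<eta> in ?\<pi>. norm (g (\<eta> x) * (measure_pmf.expectation p (\<lambda>y. h (move \<eta> x (x + y))) - h \<eta>))
        \<le> norm ((2 * B) * g (\<eta> x))"
      using B by (auto simp: abs_mult mult.commute[of "2 * B"] intro!: mult_left_mono)
  qed simp
  have eq: "measure_pmf.expectation ?\<pi> (\<lambda>\<eta>. g (\<eta> x) * (measure_pmf.expectation p (\<lambda>y. h (move \<eta> x (x + y))) - h \<eta>))
      = \<psi> * measure_pmf.expectation ?\<pi> (\<lambda>\<eta>. measure_pmf.expectation p (\<lambda>y. k \<eta> (x + y)) - k \<eta> x)"
    if "x \<in> A" for x
    unfolding expectation_Pi_pmf_shift[of A x g q \<psi>, OF A that g0 shift] move_add k_def
    by (simp add: integrable_measure_pmf_bounded[of _ B, OF h])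
  have int2: "integrable ?\<pi> (\<lambda>\<eta>. measure_pmf.expectation p (\<lambda>y. k \<eta> (x + y)) - k \<eta> x)" for x
    by (intro Bochner_Integration.integrable_diff integrable_measure_pmf_bounded[of _ "2 * B"]
          abs_expectation_le kB) (use B in simp)
  have "measure_pmf.expectation ?\<pi> (\<lambda>\<eta>. \<Sum>x\<in>A. g (\<eta> x) * (measure_pmf.expectation p (\<lambda>y. h (move \<eta> x (x + y))) - h \<eta>))
      = \<psi> * measure_pmf.expectation ?\<pi> (\<lambda>\<eta>. \<Sum>x\<in>A. measure_pmf.expectation p (\<lambda>y. k \<eta> (x + y)) - k \<eta> x)"
    by (simp only: Bochner_Integration.integral_sum int int2 eq sum_distrib_left cong: sum.cong)
  moreover have "\<bar>measure_pmf.expectation ?\<pi> (\<lambda>\<eta>. \<Sum>x\<in>A. measure_pmf.expectation p (\<lambda>y. k \<eta> (x + y)) - k \<eta> x)\<bar>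
      \<le> c * boundary_flux p A"
  proof (rule abs_expectation_le)
    fix \<eta> assume "\<eta> \<in> set_pmf ?\<pi>"
    then have "\<And>x. x \<notin> A \<Longrightarrow> \<eta> x = 0" using set_Pi_pmf_subset[OF A, of 0 "\<lambda>_. q"] by auto
    then have "\<eta> \<in> finite_configs"
      using A by (intro supported_mem_finite_configs[of A]) auto
    then show "\<bar>\<Sum>x\<in>A. measure_pmf.expectation p (\<lambda>y. k \<eta> (x + y)) - k \<eta> x\<bar> \<le> c * boundary_flux p A"
      using lip by (intro sum_expectation_increment_le A) (simp add: k_def)
  next
    show "0 \<le> c * boundary_flux p A"
      using \<open>0 \<le> c\<close> unfolding boundary_flux_def by (intro mult_nonneg_nonneg integral_nonneg) auto
  qed
  ultimately show ?thesis using \<open>0 \<le> \<psi>\<close> by (simp add: abs_mult mult_left_mono)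
qed

section \<open>Evolution in a finite box\<close>

text \<open>The chain provides right derivatives only. At the last time \<open>m\<close> at which
  the linear bound holds, the right derivative would carry the bound beyond \<open>m\<close>, unless
  \<open>m = T\<close>.\<close>

lemma mean_value_right:
  fixes F :: "real \<Rightarrow> real"
  assumes T: "0 \<le> T" and cont: "continuous_on {0..T} F"
    and der: "\<And>t. 0 \<le> t \<Longrightarrow> t < T \<Longrightarrow>
      \<exists>D. \<bar>D\<bar> \<le> \<epsilon> \<and> ((\<lambda>s. (F (t + s) - F t) / s) \<longlongrightarrow> D) (at_right 0)"
  shows "\<bar>F T - F 0\<bar> \<le> \<epsilon> * T"
proof (cases "T = 0")
  case False
  then have "T > 0" using T by simp
  \<comment> \<open>The slack \<open>e\<close> turns the bound on the limit \<open>D\<close> into a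
    strict bound on nearby difference quotients.\<close>
  have "\<bar>F T - F 0\<bar> \<le> (\<epsilon> + e) * T" if "e > 0" for e
  proof (rule ccontr)
    assume neg: "\<not> \<bar>F T - F 0\<bar> \<le> (\<epsilon> + e) * T"
    define U where "U = {t \<in> {0..T}. \<bar>F t - F 0\<bar> \<le> (\<epsilon> + e) * t}"
    have "closed U" unfolding U_def
      by (intro continuous_on_closed_Collect_le continuous_intros cont)
    moreover have "bounded U" unfolding U_def by (rule bounded_subset[of "{0..T}"]) auto
    ultimately have "compact U" by (simp add: compact_eq_bounded_closed)
    moreover have "0 \<in> U" using T by (simp add: U_def)
    ultimately obtain m where m: "m \<in> U" "\<And>t. t \<in> U \<Longrightarrow> t \<le> m"
      using compact_attains_sup[of U] by blast
    have "m \<noteq> T" using m(1) neg by (auto simp: U_def)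
    then have mT: "0 \<le> m" "m < T" using m(1) by (auto simp: U_def)
    obtain D where D: "\<bar>D\<bar> \<le> \<epsilon>" "((\<lambda>s. (F (m + s) - F m) / s) \<longlongrightarrow> D) (at_right 0)"
      using der[OF mT] by blast
    have "eventually (\<lambda>s. \<bar>(F (m + s) - F m) / s\<bar> < \<epsilon> + e) (at_right 0)"
      using tendsto_rabs[OF D(2)] by (rule order_tendstoD) (use D(1) \<open>e > 0\<close> in linarith)
    moreover have "eventually (\<lambda>s. 0 < s \<and> s < T - m) (at_right 0)"
      unfolding eventually_at_right[OF zero_less_one] using mT by (auto intro!: exI[of _ "T - m"])
    ultimately have "eventually (\<lambda>s. False) (at_right (0::real))"
    proof eventually_elim
      case (elim s)
      then have "\<bar>F (m + s) - F m\<bar> \<le> (\<epsilon> + e) * s" by (simp add: abs_divide pos_divide_less_eq)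
      moreover have "\<bar>F m - F 0\<bar> \<le> (\<epsilon> + e) * m" using m(1) by (simp add: U_def)
      ultimately have "\<bar>F (m + s) - F 0\<bar> \<le> (\<epsilon> + e) * (m + s)" by (simp add: distrib_left)
      then have "m + s \<in> U" using elim mT by (simp add: U_def)
      then show False using m(2)[of "m + s"] elim by simp
    qed
    then show False by simp
  qed
  \<comment> \<open>The choice is \<open>e = d / T\<close>.\<close>
  then have "\<bar>F T - F 0\<bar> \<le> \<epsilon> * T + d" if "d > 0" for d
    using that[THEN divide_pos_pos, OF \<open>T > 0\<close>] \<open>T > 0\<close> 
    by (metis (no_types, opaque_lifting) distrib_right nonzero_eq_divide_eq order_less_irrefl)
  then show ?thesis by (rule field_le_epsilon)
qed simp

text \<open>The family \<open>h t\<close> stands for \<open>P t f\<close> on finite configurations.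
  Its box average \<open>F\<close> is Lipschitz in time by the increment bound, and its right
  derivative is the averaged generator, so the mean value inequality applies.\<close>

lemma zr_box_drift_le:
  fixes p :: "('d::finite) site pmf" and h :: "real \<Rightarrow> 'd config \<Rightarrow> real"
  assumes g0: "g 0 = 0" and gnn: "\<And>k. 0 \<le> g k" and K: "zr_chain p g K"
    and A: "finite A" and shift: "\<And>k. pmf q (Suc k) * g (Suc k) = \<psi> * pmf q k" and "0 \<le> \<psi>"
    and ig: "integrable (measure_pmf q) g"
    and h: "\<And>t \<eta>. 0 \<le> t \<Longrightarrow> \<bar>h t \<eta>\<bar> \<le> B"
    and markov: "\<And>s t \<eta>. 0 \<le> s \<Longrightarrow> 0 \<le> t \<Longrightarrow> \<eta> \<in> finite_configs \<Longrightarrow>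
      h (t + s) \<eta> = measure_pmf.expectation (K s \<eta>) (h t)"
    and lip: "\<And>t \<eta> z. 0 \<le> t \<Longrightarrow> t \<le> T \<Longrightarrow> \<eta> \<in> finite_configs \<Longrightarrow>
      \<bar>h t (\<eta>(z := \<eta> z + 1)) - h t \<eta>\<bar> \<le> c * beta p z"
    and "0 \<le> c" "0 \<le> T"
  shows "\<bar>measure_pmf.expectation (Pi_pmf A 0 (\<lambda>_. q)) (h T) - measure_pmf.expectation (Pi_pmf A 0 (\<lambda>_. q)) (h 0)\<bar>
    \<le> \<psi> * (c * boundary_flux p A) * T"
proof -
  let ?\<pi> = "Pi_pmf A 0 (\<lambda>_. q)"
  define F where "F t = measure_pmf.expectation ?\<pi> (h t)" for t
  define R where "R \<eta> = (\<Sum>x\<in>A. g (\<eta> x))" for \<eta> :: "'d config"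
  have Rnn: "0 \<le> R \<eta>" for \<eta> unfolding R_def by (intro sum_nonneg gnn)
  have iR: "integrable ?\<pi> R"
    unfolding R_def by (intro Bochner_Integration.integrable_sum integrable_Pi_pmf_component A ig)
  have ih: "integrable ?\<pi> (h t)" if "0 \<le> t" for t
    by (rule integrable_measure_pmf_bounded[OF h[OF that]])
  have supp: "\<eta> x = 0" if "\<eta> \<in> set_pmf ?\<pi>" "x \<notin> A" for \<eta> x
    using set_Pi_pmf_subset[OF A, of 0 "\<lambda>_. q"] that by auto
  have fin: "\<eta> \<in> finite_configs" if "\<eta> \<in> set_pmf ?\<pi>" for \<eta>
    using supported_mem_finite_configs[OF A] supp[OF that] by blast
  have incr: "\<bar>h (t + s) \<eta> - h t \<eta>\<bar> \<le> 2 * B * (s * R \<eta>)"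
    if "0 \<le> t" "0 \<le> s" "\<eta> \<in> set_pmf ?\<pi>" for s t \<eta>
    unfolding R_def markov[OF that(2,1) fin[OF that(3)]]
    using zr_chain_increment[OF g0 gnn K A supp[OF that(3)] that(2) h[OF that(1)]] .
  have B: "0 \<le> B" using h[of 0 undefined] by linarith
  have F_diff: "F (t + s) - F t = measure_pmf.expectation ?\<pi> (\<lambda>\<eta>. h (t + s) \<eta> - h t \<eta>)"
    if "0 \<le> t" "0 \<le> s" for s t
    using that ih by (simp add: F_def)
  have F_incr: "\<bar>F (t + s) - F t\<bar> \<le> (2 * B * measure_pmf.expectation ?\<pi> R) * s" if "0 \<le> t" "0 \<le> s" for s t
  proof -
    have "\<bar>F (t + s) - F t\<bar> \<le> measure_pmf.expectation ?\<pi> (\<lambda>\<eta>. \<bar>h (t + s) \<eta> - h t \<eta>\<bar>)"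
      unfolding F_diff[OF that] by (rule integral_abs_bound)
    also have "\<dots> \<le> measure_pmf.expectation ?\<pi> (\<lambda>\<eta>. 2 * B * (s * R \<eta>))"
      using that ih iR incr by (intro integral_mono_AE) (auto simp: AE_measure_pmf_iff)
    finally show ?thesis by (simp add: mult_ac)
  qed
  have cont: "continuous_on {0..T} F"
  proof -
    define L where "L = 2 * B * measure_pmf.expectation ?\<pi> R"
    have "0 \<le> L" unfolding L_def using B Rnn by (intro mult_nonneg_nonneg integral_nonneg) auto
    have *: "\<bar>F t - F u\<bar> \<le> L * \<bar>t - u\<bar>" if "0 \<le> t" "0 \<le> u" for t u
      using F_incr[of t "u - t"] F_incr[of u "t - u"] that by (cases "t \<le> u") (auto simp: L_def abs_minus_commute)
    have "L-lipschitz_on {0..T} F"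
      by (rule lipschitz_onI) (use * \<open>0 \<le> L\<close> in \<open>auto simp: dist_real_def\<close>)
    then show ?thesis by (rule lipschitz_on_continuous_on)
  qed
  have "\<exists>D. \<bar>D\<bar> \<le> \<psi> * (c * boundary_flux p A) \<and> ((\<lambda>s. (F (t + s) - F t) / s) \<longlongrightarrow> D) (at_right 0)"
    if t: "0 \<le> t" "t < T" for t
  proof (intro exI conjI)
    let ?D = "measure_pmf.expectation ?\<pi>
      (\<lambda>\<eta>. \<Sum>x\<in>A. g (\<eta> x) * (measure_pmf.expectation p (\<lambda>y. h t (move \<eta> x (x + y))) - h t \<eta>))"
    show "\<bar>?D\<bar> \<le> \<psi> * (c * boundary_flux p A)"
      using A g0 shift \<open>0 \<le> \<psi>\<close> ig h[OF t(1)] lip[OF t(1) less_imp_le[OF t(2)]] \<open>0 \<le> c\<close>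
      by (rule expectation_generator_le)
    show "((\<lambda>s. (F (t + s) - F t) / s) \<longlongrightarrow> ?D) (at_right 0)"
    \<comment> \<open>Passing to sequences allows dominated convergence, with majorant
      \<open>2 * B * R\<close> from the increment bound; it is integrable because \<open>g\<close>
      is integrable under \<open>q\<close>.\<close>
    proof (rule tendsto_at_right_sequentially[of 0 1])
      fix S :: "nat \<Rightarrow> real" assume S: "\<And>n. 0 < S n" "S \<longlonglongrightarrow> 0"
      have lim: "filterlim S (at_right 0) sequentially"
        by (rule tendsto_imp_filterlim_at_right) (use S in auto)
      have "(\<lambda>n. measure_pmf.expectation ?\<pi> (\<lambda>\<eta>. (h (t + S n) \<eta> - h t \<eta>) / S n)) \<longlonglongrightarrow> ?D"
      proof (rule integral_dominated_convergence[where w = "\<lambda>\<eta>. 2 * B * R \<eta>"])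
        show "AE \<eta> in ?\<pi>. (\<lambda>n. (h (t + S n) \<eta> - h t \<eta>) / S n) \<longlonglongrightarrow>
          (\<Sum>x\<in>A. g (\<eta> x) * (measure_pmf.expectation p (\<lambda>y. h t (move \<eta> x (x + y))) - h t \<eta>))"
          unfolding AE_measure_pmf_iff
        proof
          fix \<eta> assume \<eta>: "\<eta> \<in> set_pmf ?\<pi>"
          have "(\<lambda>n. (measure_pmf.expectation (K (S n) \<eta>) (h t) - h t \<eta>) / S n) \<longlonglongrightarrow> zr_generator p g (h t) \<eta>"
            using filterlim_compose[OF zr_chain_right_derivative[OF K h[OF t(1)] fin[OF \<eta>]] lim] .
          moreover have "h (t + S n) \<eta> = measure_pmf.expectation (K (S n) \<eta>) (h t)" for n
            using S(1)[of n] t fin[OF \<eta>] by (intro markov) auto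
          moreover have "zr_generator p g (h t) \<eta> =
              (\<Sum>x\<in>A. g (\<eta> x) * (measure_pmf.expectation p (\<lambda>y. h t (move \<eta> x (x + y))) - h t \<eta>))"
            using g0 A supp[OF \<eta>] h[OF t(1)] by (rule zr_generator_eq)
          ultimately show "(\<lambda>n. (h (t + S n) \<eta> - h t \<eta>) / S n) \<longlonglongrightarrow>
            (\<Sum>x\<in>A. g (\<eta> x) * (measure_pmf.expectation p (\<lambda>y. h t (move \<eta> x (x + y))) - h t \<eta>))"
            by simp
        qed
        show "AE \<eta> in ?\<pi>. norm ((h (t + S n) \<eta> - h t \<eta>) / S n) \<le> 2 * B * R \<eta>" for n
          unfolding AE_measure_pmf_iff
        proof
          fix \<eta> assume "\<eta> \<in> set_pmf ?\<pi>"
          from incr[OF t(1) less_imp_le[OF S(1)[of n]] this] show "norm ((h (t + S n) \<eta> - h t \<eta>) / S n) \<le> 2 * B * R \<eta>"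
            using S(1)[of n] by (simp add: abs_divide pos_divide_le_eq mult_ac)
        qed
      qed (use iR in auto)
      then show "(\<lambda>n. (F (t + S n) - F t) / S n) \<longlonglongrightarrow> ?D"
        using F_diff[OF t(1) less_imp_le[OF S(1)]] by simp
    qed simp
  qed
  from mean_value_right[OF \<open>0 \<le> T\<close> cont this] show ?thesis by (simp add: F_def)
qed

section \<open>The infinite product measure\<close>

lemma countable_range_cutoff:
  assumes "finite A"
  shows "countable (range (cutoff A))"
proof -
  have "range (cutoff A) \<subseteq> cutoff A ` PiE A (\<lambda>_. UNIV)"
  proof
    fix \<zeta> assume "\<zeta> \<in> range (cutoff A)"
    then obtain \<eta> where "\<zeta> = cutoff A \<eta>" by blast
    then have "\<zeta> = cutoff A (restrict \<eta> A)" by (auto simp: cutoff_def)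
    then show "\<zeta> \<in> cutoff A ` PiE A (\<lambda>_. UNIV)" by auto
  qed
  moreover have "countable (PiE A (\<lambda>_. UNIV :: nat set))"
    using assms by (intro countable_PiE) auto
  ultimately show ?thesis by (meson countable_image countable_subset)
qed

lemma cutoff_vimage:
  "a \<in> range (cutoff A) \<Longrightarrow> cutoff A -` {a} = {\<eta>. \<forall>x\<in>A. \<eta> x = a x}"
  by (auto simp: cutoff_def fun_eq_iff split: if_splits)

text \<open>The target carries the full power set, so any real function of the truncated
  configuration becomes measurable. Countability of the range reduces the claim to cylinder
  events.\<close>

lemma cutoff_measurable:
  assumes "finite A"
  shows "cutoff A \<in> measurable (\<Pi>\<^sub>M x\<in>UNIV. count_space UNIV) (count_space UNIV)"
proof -
  let ?M = "(\<Pi>\<^sub>M x\<in>UNIV. count_space UNIV) :: ('a \<Rightarrow> nat) measure"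
  have "cutoff A -` {a} \<inter> space ?M \<in> sets ?M" if "a \<in> range (cutoff A)" for a
  proof -
    have "cutoff A -` {a} \<inter> space ?M = {\<eta> \<in> space ?M. \<forall>x\<in>A. \<eta> x = a x}"
      using cutoff_vimage[OF that] by auto
    also have "\<dots> \<in> sets ?M" using assms by measurable
    finally show ?thesis .
  qed
  then have "cutoff A \<in> measurable ?M (count_space (range (cutoff A)))"
    using countable_range_cutoff[OF assms] by (subst measurable_count_space_eq_countable) auto
  from measurable_comp[OF this, of "\<lambda>x. x" "count_space UNIV"] show ?thesis by (simp add: comp_def)
qed

lemma sets_PiM_pmf: "sets (\<Pi>\<^sub>M x\<in>I. measure_pmf q) = sets (\<Pi>\<^sub>M x\<in>I. count_space UNIV)"
  by (rule sets_PiM_cong) auto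

lemma cutoff_measurable_pmf:
  assumes "finite A"
  shows "cutoff A \<in> measurable (\<Pi>\<^sub>M x\<in>UNIV. measure_pmf q) (count_space UNIV)"
  using cutoff_measurable[OF assms] measurable_cong_sets[OF sets_PiM_pmf refl] by blast

text \<open>Both laws live on the countable range of \<open>cutoff A\<close>, so comparing
  singletons suffices; the preimage of a singleton is a cylinder with base \<open>A\<close>.\<close>

lemma distr_cutoff:
  assumes A: "finite A"
  shows "distr (\<Pi>\<^sub>M x\<in>UNIV. measure_pmf q) (count_space UNIV) (cutoff A) = measure_pmf (Pi_pmf A 0 (\<lambda>_. q))"
proof -
  let ?M = "\<Pi>\<^sub>M x\<in>UNIV. measure_pmf q" and ?\<pi> = "Pi_pmf A 0 (\<lambda>_. q)"
  note m = cutoff_measurable_pmf[OF A, of q]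
  show ?thesis
  proof (rule measure_eqI_countable_AE[OF _ _ _ _ countable_range_cutoff[OF A]])
    show "AE \<eta> in distr ?M (count_space UNIV) (cutoff A). \<eta> \<in> range (cutoff A)"
      by (subst AE_distr_iff[OF m]) auto
    show "AE \<eta> in ?\<pi>. \<eta> \<in> range (cutoff A)"
      unfolding AE_measure_pmf_iff
    proof
      fix \<eta> assume "\<eta> \<in> set_pmf ?\<pi>"
      then have "\<eta> = cutoff A \<eta>" using set_Pi_pmf_subset[OF A, of 0 "\<lambda>_. q"] by (auto simp: cutoff_def fun_eq_iff)
      then show "\<eta> \<in> range (cutoff A)" by blast
    qed
    fix a assume a: "a \<in> range (cutoff A)"
    have "emeasure (distr ?M (count_space UNIV) (cutoff A)) {a} = emeasure ?M (cutoff A -` {a} \<inter> space ?M)"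
      by (rule emeasure_distr[OF m]) simp
    also have "cutoff A -` {a} \<inter> space ?M = prod_emb UNIV (\<lambda>_. measure_pmf q) A (PiE A (\<lambda>x. {a x}))"
      unfolding cutoff_vimage[OF a] by (auto simp: prod_emb_def space_PiM PiE_iff)
    also have "emeasure ?M \<dots> = (\<Prod>x\<in>A. emeasure (measure_pmf q) {a x})"
      using A by (intro emeasure_PiM_emb) (auto intro: measure_pmf.prob_space_axioms)
    also have "\<dots> = ennreal (\<Prod>x\<in>A. pmf q (a x))"
      by (simp add: emeasure_pmf_single prod_ennreal)
    also have "\<dots> = emeasure ?\<pi> {a}"
      using a by (auto simp: emeasure_pmf_single pmf_Pi[OF A] cutoff_def)
    finally show "emeasure (distr ?M (count_space UNIV) (cutoff A)) {a} = emeasure ?\<pi> {a}" .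
  qed auto
qed

text \<open>By Tonelli the expected norm is the total mass 2 of \<open>beta\<close> times the mean
  of \<open>q\<close>, hence finite, so the norm is almost surely finite.\<close>

lemma AE_PiM_Omega':
  fixes p :: "('d::finite) site pmf"
  assumes q: "integrable (measure_pmf q) real"
  shows "AE \<eta> in (\<Pi>\<^sub>M x\<in>UNIV. measure_pmf q). \<eta> \<in> Omega' p"
proof -
  let ?M = "(\<Pi>\<^sub>M x\<in>UNIV. measure_pmf q) :: 'd config measure"
  have m: "(\<lambda>\<eta>. \<integral>\<^sup>+x. ennreal (real (\<eta> x) * beta p x) \<partial>count_space UNIV) \<in> borel_measurable ?M"
    using borel_measurable_config_norm[of p] measurable_cong_sets[OF sets_PiM_pmf refl] by blast
  have comp: "(\<lambda>\<eta>. \<eta> x) \<in> measurable ?M (measure_pmf q)" for x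
    by (rule measurable_component_singleton) simp
  have "(\<integral>\<^sup>+\<eta>. \<integral>\<^sup>+x. ennreal (real (\<eta> x) * beta p x) \<partial>count_space UNIV \<partial>?M) =
      (\<integral>\<^sup>+x. \<integral>\<^sup>+\<eta>. ennreal (real (\<eta> x) * beta p x) \<partial>?M \<partial>count_space UNIV)"
    by (rule nn_integral_count_space_nn_integral) (auto intro!: measurable_compose[OF comp])
  also have "\<dots> = (\<integral>\<^sup>+x. ennreal (beta p x) * (\<integral>\<^sup>+k. ennreal (real k) \<partial>measure_pmf q) \<partial>count_space UNIV)"
  proof (rule nn_integral_cong)
    fix x :: "'d site"
    have "(\<integral>\<^sup>+\<eta>. ennreal (real (\<eta> x) * beta p x) \<partial>?M) =
        (\<integral>\<^sup>+k. ennreal (real k * beta p x) \<partial>distr ?M (measure_pmf q) (\<lambda>\<eta>. \<eta> x))"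
      by (rule nn_integral_distr[OF comp, symmetric]) simp
    also have "distr ?M (measure_pmf q) (\<lambda>\<eta>. \<eta> x) = measure_pmf q"
      by (rule distr_PiM_component) (auto intro: measure_pmf.prob_space_axioms)
    also have "(\<integral>\<^sup>+k. ennreal (real k * beta p x) \<partial>measure_pmf q) =
        ennreal (beta p x) * (\<integral>\<^sup>+k. ennreal (real k) \<partial>measure_pmf q)"
      by (subst nn_integral_cmult[symmetric]) (simp_all add: ennreal_mult mult.commute)
    finally show "(\<integral>\<^sup>+\<eta>. ennreal (real (\<eta> x) * beta p x) \<partial>?M) =
        ennreal (beta p x) * (\<integral>\<^sup>+k. ennreal (real k) \<partial>measure_pmf q)" .
  qed
  also have "\<dots> = 2 * (\<integral>\<^sup>+k. ennreal (real k) \<partial>measure_pmf q)"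
    by (subst nn_integral_multc) (simp_all add: nn_integral_beta)
  also have "\<dots> < \<infinity>"
    using integrableD(2)[OF q] by (simp add: ennreal_mult_less_top top.not_eq_extremum)
  finally have "AE \<eta> in ?M. (\<integral>\<^sup>+x. ennreal (real (\<eta> x) * beta p x) \<partial>count_space UNIV) \<noteq> \<infinity>"
    by (intro nn_integral_PInf_AE m) auto
  then show ?thesis by (simp add: Omega'_eq top.not_eq_extremum)
qed

text \<open>The box law is the law of the truncated configuration. Truncations converge to
  \<open>\<eta>\<close> in the weighted distance on \<open>\<Omega>'\<close>, \<open>u\<close> is
  Lipschitz there, and dominated convergence concludes.\<close>

lemma expectation_box_tendsto:
  fixes p :: "('d::finite) site pmf"
  assumes q: "integrable (measure_pmf q) real"
    and u: "u \<in> lip_functions p" and B: "\<And>\<eta>. \<eta> \<in> finite_configs \<Longrightarrow> \<bar>u \<eta>\<bar> \<le> B"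
  shows "(\<lambda>n. measure_pmf.expectation (Pi_pmf (enum_box n) 0 (\<lambda>_. q))
      (\<lambda>\<eta>. if \<eta> \<in> finite_configs then u \<eta> else 0))
    \<longlonglongrightarrow> (LINT \<eta>:Omega' p|(\<Pi>\<^sub>M x\<in>UNIV. measure_pmf q). u \<eta>)"
proof -
  let ?M = "(\<Pi>\<^sub>M x\<in>UNIV. measure_pmf q) :: 'd config measure"
  let ?c = "\<lambda>n. cutoff (enum_box n)"
  define v where "v \<eta> = (if \<eta> \<in> finite_configs then u \<eta> else 0)" for \<eta>
  interpret prob_space ?M by (rule prob_space_PiM) (rule measure_pmf.prob_space_axioms)
  have m: "?c n \<in> measurable ?M (count_space UNIV)" for n
    by (intro cutoff_measurable_pmf finite_enum_box)
  have [measurable]: "(\<lambda>\<eta>. v (?c n \<eta>)) \<in> borel_measurable ?M" for n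
    by (rule measurable_compose[OF m]) simp
  have [measurable]: "Omega' p \<in> sets ?M" using sets_Omega'[of p] by (simp add: sets_PiM_pmf)
  have v_le: "\<bar>v \<eta>\<bar> \<le> B" for \<eta>
    using B[of \<eta>] B[of "\<lambda>_. 0"] by (auto simp: v_def finite_configs_def)
  have eq: "measure_pmf.expectation (Pi_pmf (enum_box n) 0 (\<lambda>_. q)) v =
      (\<integral>\<eta>. indicator (Omega' p) \<eta> *\<^sub>R v (?c n \<eta>) \<partial>?M)" for n
  proof -
    have "measure_pmf.expectation (Pi_pmf (enum_box n) 0 (\<lambda>_. q)) v = (\<integral>\<eta>. v (?c n \<eta>) \<partial>?M)"
      unfolding distr_cutoff[OF finite_enum_box, symmetric] by (rule integral_distr[OF m]) simp
    also have "\<dots> = (\<integral>\<eta>. indicator (Omega' p) \<eta> *\<^sub>R v (?c n \<eta>) \<partial>?M)"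
      using AE_PiM_Omega'[OF q, of p] by (intro integral_cong_AE) auto
    finally show ?thesis .
  qed
  have lim: "(\<lambda>n. indicator (Omega' p) \<eta> *\<^sub>R v (?c n \<eta>)) \<longlonglongrightarrow> indicator (Omega' p) \<eta> *\<^sub>R u \<eta>" for \<eta>
  proof (cases "\<eta> \<in> Omega' p")
    case True
    have z: "(\<lambda>n. lip_const p u * config_dist p \<eta> (?c n \<eta>)) \<longlonglongrightarrow> 0"
      by (intro tendsto_mult_right_zero config_dist_cutoff_tendsto True)
    have "norm (v (?c n \<eta>) - u \<eta>) \<le> lip_const p u * config_dist p \<eta> (?c n \<eta>)" for n
      using lip_bound_lip_const[OF u] True cutoff_mem_finite_configs[of "enum_box n" \<eta>]
        finite_configs_subset_Omega'[of p]
      by (auto simp: lip_bound_def v_def abs_minus_commute)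
    then have "(\<lambda>n. v (?c n \<eta>) - u \<eta>) \<longlonglongrightarrow> 0"
      by (intro Lim_null_comparison[OF _ z] always_eventually allI)
    then show ?thesis using True by (simp add: LIM_zero_iff)
  qed simp
  have "(\<lambda>n. \<integral>\<eta>. indicator (Omega' p) \<eta> *\<^sub>R v (?c n \<eta>) \<partial>?M) \<longlonglongrightarrow>
      (\<integral>\<eta>. indicator (Omega' p) \<eta> *\<^sub>R u \<eta> \<partial>?M)"
  proof (rule integral_dominated_convergence[where w = "\<lambda>_. B"])
    \<comment> \<open>Measurability of \<open>u\<close> on \<open>\<Omega>'\<close> is inherited
      from its approximations through truncated configurations.\<close>
    show "(\<lambda>\<eta>. indicator (Omega' p) \<eta> *\<^sub>R u \<eta>) \<in> borel_measurable ?M"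
      by (rule borel_measurable_LIMSEQ_real[OF lim]) measurable
    show "AE \<eta> in ?M. norm (indicator (Omega' p) \<eta> *\<^sub>R v (?c n \<eta>)) \<le> B" for n
      using v_le order_trans[OF abs_ge_zero v_le] by (auto simp: indicator_def)
  qed (use lim in auto)
  then show ?thesis unfolding set_lebesgue_integral_def eq[unfolded v_def[abs_def]] v_def[abs_def] .
qed

section \<open>Invariance by exhausting the lattice\<close>

theorem theorem8p1p2:
  fixes p :: "('d::finite) site pmf"
    and g :: "nat \<Rightarrow> real"
    and a0 \<rho> :: real
    and K :: "real \<Rightarrow> 'd config \<Rightarrow> 'd config pmf"
    and P :: "real \<Rightarrow> ('d config \<Rightarrow> real) \<Rightarrow> 'd config \<Rightarrow> real"
  assumes "g 0 = 0"
    and "\<And>k. k \<ge> 1 \<Longrightarrow> g k > 0"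
    and "\<And>k. \<bar>g (k + 1) - g k\<bar> \<le> a0"
    and "irreducible_walk p"
    and "zr_chain p g K"
    and "zr_semigroup p a0 K P"
    and "0 \<le> \<rho>"
    and "ereal \<rho> < crit_density g"
  shows "nu g \<rho> \<in> invariant_measures p P"
proof -
  note g0 = assms(1) and gpos = assms(2) and K = assms(5) and P = assms(6)
  define \<psi> where "\<psi> = fugacity_of g \<rho>"
  define q where "q = kappa g \<psi>"
  have \<psi>: "\<psi> \<in> fugacities g"
    unfolding \<psi>_def using gpos assms(7,8) by (rule fugacity_of_mem)
  then have \<psi>0: "0 \<le> \<psi>" by (simp add: fugacities_def)
  have gnn: "0 \<le> g k" for k using g0 gpos[of k] by (cases k) (auto intro: less_imp_le)
  have shift: "pmf q (Suc k) * g (Suc k) = \<psi> * pmf q k" for k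
    unfolding q_def by (rule kappa_shift[OF gpos \<psi>])
  have iq: "integrable (measure_pmf q) real"
    unfolding q_def by (rule integrable_kappa_real[OF gpos \<psi>])
  have a0: "0 \<le> a0" using assms(3)[of 0] by linarith
  \<comment> \<open>Linear growth makes \<open>g\<close> integrable, since the one-site law has a
    finite mean.\<close>
  have g_le: "g k \<le> a0 * real k" for k
  proof (induction k)
    case (Suc k)
    then show ?case using assms(3)[of k] by (simp add: algebra_simps)
  qed (simp add: g0)
  have ig: "integrable (measure_pmf q) g"
    by (rule Bochner_Integration.integrable_bound[of _ "\<lambda>k. a0 * real k"])
       (use iq gnn g_le a0 in auto)
  let ?M = "(\<Pi>\<^sub>M x\<in>UNIV. measure_pmf q) :: 'd config measure"
  have nu: "nu g \<rho> = ?M" by (simp add: nu_def q_def \<psi>_def)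
  interpret prob_space ?M by (rule prob_space_PiM) (rule measure_pmf.prob_space_axioms)
  have Om: "Omega' p \<in> sets ?M" using sets_Omega'[of p] by (simp add: sets_PiM_pmf)
  have "(LINT \<eta>:Omega' p|?M. P T f \<eta>) = (LINT \<eta>:Omega' p|?M. f \<eta>)"
    if f: "f \<in> lip_functions p" and bdd: "bounded (f ` Omega' p)" and T: "0 \<le> T" for f T
  proof -
    obtain B where B: "\<And>\<eta>. \<eta> \<in> Omega' p \<Longrightarrow> \<bar>f \<eta>\<bar> \<le> B"
      using bdd by (auto simp: bounded_iff)
    have fin_Om: "\<eta> \<in> Omega' p" if "\<eta> \<in> finite_configs" for \<eta>
      using finite_configs_subset_Omega' that by blast
    have zero: "(\<lambda>_. 0) \<in> finite_configs" by (simp add: finite_configs_def)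
    have B0: "0 \<le> B" using order_trans[OF abs_ge_zero B[OF fin_Om[OF zero]]] .
    have Plip: "P t f \<in> lip_functions p" if "0 \<le> t" for t
      using P f that by (simp add: zr_semigroup_def)
    have supp: "set_pmf (K t \<eta>) \<subseteq> finite_configs" if "0 \<le> t" "\<eta> \<in> finite_configs" for t \<eta>
      using K that by (simp add: zr_chain_def)
    have Pexp: "P t u \<eta> = measure_pmf.expectation (K t \<eta>) u"
      if "0 \<le> t" "u \<in> lip_functions p" "\<eta> \<in> finite_configs" for t u \<eta>
      using P that by (simp add: zr_semigroup_def)
    have Pbd: "\<bar>P t f \<eta>\<bar> \<le> B" if "0 \<le> t" "\<eta> \<in> finite_configs" for t \<eta>
      unfolding Pexp[OF that(1) f that(2)]
      using supp[OF that] fin_Om by (intro abs_expectation_le B B0) auto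
    \<comment> \<open>The value 0 elsewhere makes \<open>h t\<close> bounded on all configurations,
      as the chain lemmas require; the chain stays among finite configurations, so its expectations
      are unchanged.\<close>
    define h where "h t \<eta> = (if \<eta> \<in> finite_configs then P t f \<eta> else 0)" for t \<eta>
    \<comment> \<open>This constant bounds the Lipschitz constants of \<open>P t f\<close>
      simultaneously for all \<open>t\<close> up to \<open>T\<close>.\<close>
    define c where "c = lip_const p f * exp (4 * a0 * T)"
    have c0: "0 \<le> c"
      unfolding c_def using lip_bound_nonneg[OF lip_bound_lip_const[OF f]] by simp
    have h_le: "\<bar>h t \<eta>\<bar> \<le> B" if "0 \<le> t" for t \<eta>
      using Pbd[OF that] B0 by (simp add: h_def)
    have markov: "h (t + s) \<eta> = measure_pmf.expectation (K s \<eta>) (h t)"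
      if "0 \<le> s" "0 \<le> t" "\<eta> \<in> finite_configs" for s t \<eta>
    proof -
      \<comment> \<open>With \<open>P s\<close> outermost, the chain runs for time \<open>s\<close>
        and is tested against \<open>P t f\<close>, so \<open>t\<close> can be the base point of the
        right derivative.\<close>
      have "P (s + t) f = P s (P t f)" using P f that by (simp add: zr_semigroup_def)
      then have "h (t + s) \<eta> = measure_pmf.expectation (K s \<eta>) (P t f)"
        using that Pexp[OF that(1) Plip[OF that(2)] that(3)] by (simp add: h_def add.commute)
      also have "\<dots> = measure_pmf.expectation (K s \<eta>) (h t)"
        using supp[OF that(1,3)] by (intro integral_cong_AE) (auto simp: AE_measure_pmf_iff h_def)
      finally show ?thesis .
    qed
    have lip: "\<bar>h t (\<eta>(z := \<eta> z + 1)) - h t \<eta>\<bar> \<le> c * beta p z"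
      if t: "0 \<le> t" "t \<le> T" and \<eta>: "\<eta> \<in> finite_configs" for t \<eta> z
    proof -
      have \<eta>': "\<eta>(z := \<eta> z + 1) \<in> finite_configs"
        using \<eta> unfolding finite_configs_def
        by (auto intro: finite_subset[of _ "insert z {x. \<eta> x \<noteq> 0}"])
      have "\<bar>h t (\<eta>(z := \<eta> z + 1)) - h t \<eta>\<bar> \<le> lip_const p (P t f) * config_dist p (\<eta>(z := \<eta> z + 1)) \<eta>"
        using lip_bound_lip_const[OF Plip[OF t(1)]] \<eta> \<eta>' fin_Om by (simp add: lip_bound_def h_def)
      also have "\<dots> = lip_const p (P t f) * beta p z" by (simp only: config_dist_fun_upd)
      also have "\<dots> \<le> c * beta p z"
      proof (rule mult_right_mono)
        have "lip_const p (P t f) \<le> lip_const p f * exp (4 * a0 * t)"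
          using P f t by (simp add: zr_semigroup_def)
        also have "\<dots> \<le> c"
          unfolding c_def using lip_bound_nonneg[OF lip_bound_lip_const[OF f]] a0 t
          by (intro mult_left_mono) (auto intro!: mult_left_mono)
        finally show "lip_const p (P t f) \<le> c" .
      qed simp
      finally show ?thesis .
    qed
    define E where "E n t = measure_pmf.expectation (Pi_pmf (enum_box n) 0 (\<lambda>_. q)) (h t)" for n t
    have z: "(\<lambda>n. \<psi> * (c * boundary_flux p (enum_box n)) * T) \<longlonglongrightarrow> 0"
      by (intro tendsto_mult_right_zero tendsto_mult_left_zero boundary_flux_tendsto)
    have "norm (E n T - E n 0) \<le> \<psi> * (c * boundary_flux p (enum_box n)) * T" for n
      unfolding E_def real_norm_def
      by (rule zr_box_drift_le[OF g0 gnn K finite_enum_box shift \<psi>0 ig h_le markov lip c0 T])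
    then have "(\<lambda>n. E n T - E n 0) \<longlonglongrightarrow> 0"
      by (intro Lim_null_comparison[OF _ z] always_eventually allI)
    moreover have "(\<lambda>n. E n t) \<longlonglongrightarrow> (LINT \<eta>:Omega' p|?M. P t f \<eta>)" if "0 \<le> t" for t
      unfolding E_def h_def[abs_def] by (rule expectation_box_tendsto[OF iq Plip[OF that] Pbd[OF that]])
    ultimately have "(LINT \<eta>:Omega' p|?M. P T f \<eta>) - (LINT \<eta>:Omega' p|?M. P 0 f \<eta>) = 0"
      using T by (intro LIMSEQ_unique[OF tendsto_diff]) auto
    moreover have "P 0 f = f" using P f by (simp add: zr_semigroup_def)
    ultimately show ?thesis by simp
  qed
  then show ?thesis
    unfolding invariant_measures_def mem_Collect_eq nu
    using prob_space_axioms Om emeasure_eq_1_AE[OF Om AE_PiM_Omega'[OF iq]]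
    by (auto simp: sets_PiM_pmf)
qed

end
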